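(* The logic $\mathrm{L}(Q_{\rm Brch})$ is compact. Furthermore every consistent $\mathrm{L}(Q_{\rm Brch})$-theory $T$ has a model of cardinality $\kappa$ for every uncountable cardinal $\kappa>|T|$.
   Context: A level-tree is a structure $(A;U,V,<_1,<_2,R)$ where $A=U\cup V$; $<_1$ is a partial order on $U$ such that for every $u\in U$ the set $\{y\in U: y<_1 u\}$ is linearly ordered by $<_1$; $<_2$ is a directed partial order on $V$ with no last element; and $R$ is a strictly order preserving function from $(U,<_1)$ to $(V,<_2)$. A branch of a level-tree is a maximal $<_1$-linearly ordered subset $b\subseteq U$ such that $\{R(t):t\in b\}$ is unbounded in $(V,<_2)$. A tuple of first order formulas $(\phi_1(x),\phi_2(x),\psi_1(x,y),\psi_2(x,y),\rho(x,y,z))$ (with parameters from a model $M$) defines a level-tree in $M$ if $(\phi_1(M)\cup\phi_2(M);\phi_1(M),\phi_2(M),\psi_1^M,\psi_2^M,\rho^M)$ is a level-tree. The logic $\mathrm{L}(Q_{\rm Brch})$ adds to first order logic second order variables (ranging over branches) and a quantifier $Q_{\rm Brch}$: $Q_{\rm Brch}\, b\,(\phi_1,\phi_2,\psi_1,\psi_2,\rho)\,\Theta(b)$ holds in $M$ if, whenever the tuple defines a level-tree in $M$, there is a branch $b$ of that level-tree with $M\models\Theta(b)$. Compactness means every set of sentences all of whose finite subsets have models has a model.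
   Formalization: In the second sentence, "every consistent theory T" is replaced by "every theory T that has an infinite model"; a consistent theory with only finite models, such as one saying that all elements are equal, has no model of uncountable cardinality. *)

theory Defs
  imports Main
begin

unbundle cardinal_syntax

text \<open>
  A symbol applied to argument lists of different lengths counts as different symbols, so no
  arity function is needed: a vocabulary with prescribed arities is one that only uses
  some of these symbols, and the remaining ones are irrelevant.
\<close>

record ('f, 'p, 'a) struct =
  univ :: "'a set"
  fun_int :: "'f \<Rightarrow> 'a list \<Rightarrow> 'a"
  rel_int :: "'p \<Rightarrow> 'a list \<Rightarrow> bool"

definition is_struct :: "('f, 'p, 'a) struct \<Rightarrow> bool" where
  "is_struct M \<longleftrightarrow>
     univ M \<noteq> {} \<and> (\<forall>f as. set as \<subseteq> univ M \<longrightarrow> fun_int M f as \<in> univ M)"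


text \<open>
  All orders are strict. That \<open>U \<union> V\<close> is nonempty is the usual convention on the universe
  of a structure. \<open>R\<close> is the graph of the level function. In a directed order an upper bound
  may coincide with one of the elements it bounds, hence the reflexive closures.
\<close>

definition level_tree ::
  "'a set \<Rightarrow> 'a set \<Rightarrow> 'a rel \<Rightarrow> 'a rel \<Rightarrow> 'a rel \<Rightarrow> bool" where
  "level_tree U V lt1 lt2 R \<longleftrightarrow>
     U \<union> V \<noteq> {} \<and>
     (lt1 \<subseteq> U \<times> U \<and> irrefl lt1 \<and> trans lt1) \<and>
     (\<forall>u\<in>U. total_on {y \<in> U. (y, u) \<in> lt1} lt1) \<and>
     (lt2 \<subseteq> V \<times> V \<and> irrefl lt2 \<and> trans lt2) \<and>
     (\<forall>v\<in>V. \<forall>w\<in>V. \<exists>z\<in>V. (v, z) \<in> lt2\<^sup>= \<and> (w, z) \<in> lt2\<^sup>=) \<and>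
     \<not> (\<exists>z\<in>V. \<forall>v\<in>V. (v, z) \<in> lt2\<^sup>=) \<and>
     (R \<subseteq> U \<times> V \<and> (\<forall>u\<in>U. \<exists>!v. (u, v) \<in> R)) \<and>
     (\<forall>t u v w. (t, u) \<in> lt1 \<and> (t, v) \<in> R \<and> (u, w) \<in> R \<longrightarrow> (v, w) \<in> lt2)"

definition branch ::
  "'a set \<Rightarrow> 'a set \<Rightarrow> 'a rel \<Rightarrow> 'a rel \<Rightarrow> 'a rel \<Rightarrow> 'a set \<Rightarrow> bool" where
  "branch U V lt1 lt2 R b \<longleftrightarrow>
     b \<subseteq> U \<and> total_on b lt1 \<and>
     (\<forall>c. b \<subseteq> c \<and> c \<subseteq> U \<and> total_on c lt1 \<longrightarrow> c = b) \<and>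
     \<not> (\<exists>z\<in>V. \<forall>v \<in> R `` b. (v, z) \<in> lt2\<^sup>=)"


text \<open>
  De Bruijn indices, separately for first-order and for branch variables. In
  \<open>QBrch \<phi>1 \<phi>2 \<psi>1 \<psi>2 \<rho> \<Theta>\<close>, the formulas \<open>\<phi>1\<close>, \<open>\<phi>2\<close> bind one first-order variable \<open>x\<close>
  (index 0), the formulas \<open>\<psi>1\<close>, \<open>\<psi>2\<close>, \<open>\<rho>\<close> bind two first-order variables \<open>x\<close>, \<open>y\<close>
  (indices 0 and 1), and \<open>\<Theta>\<close> binds the branch variable \<open>b\<close>; any other free variables of
  these formulas are parameters. \<open>InBr i t\<close> is the atomic formula saying that \<open>t\<close> lies on
  the branch number \<open>i\<close>.
\<close>

datatype 'f tm = Var nat | Fn 'f "'f tm list"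

datatype ('f, 'p) fm =
    Eq "'f tm" "'f tm"
  | Rel 'p "'f tm list"
  | InBr nat "'f tm"
  | Neg "('f, 'p) fm"
  | And "('f, 'p) fm" "('f, 'p) fm"
  | Ex "('f, 'p) fm"
  | QBrch "('f, 'p) fm" "('f, 'p) fm" "('f, 'p) fm" "('f, 'p) fm" "('f, 'p) fm" "('f, 'p) fm"

primrec closed_tm :: "nat \<Rightarrow> 'f tm \<Rightarrow> bool" where
  "closed_tm m (Var i) \<longleftrightarrow> i < m"
| "closed_tm m (Fn f ts) \<longleftrightarrow> list_all (closed_tm m) ts"

text \<open>Free first-order variables are below \<open>m\<close>, free branch variables below \<open>n\<close>.\<close>

primrec closed_fm :: "nat \<Rightarrow> nat \<Rightarrow> ('f, 'p) fm \<Rightarrow> bool" where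
  "closed_fm m n (Eq s t) \<longleftrightarrow> closed_tm m s \<and> closed_tm m t"
| "closed_fm m n (Rel p ts) \<longleftrightarrow> list_all (closed_tm m) ts"
| "closed_fm m n (InBr i t) \<longleftrightarrow> i < n \<and> closed_tm m t"
| "closed_fm m n (Neg \<phi>) \<longleftrightarrow> closed_fm m n \<phi>"
| "closed_fm m n (And \<phi> \<psi>) \<longleftrightarrow> closed_fm m n \<phi> \<and> closed_fm m n \<psi>"
| "closed_fm m n (Ex \<phi>) \<longleftrightarrow> closed_fm (Suc m) n \<phi>"
| "closed_fm m n (QBrch \<phi>1 \<phi>2 \<psi>1 \<psi>2 \<rho> \<Theta>) \<longleftrightarrow>
     closed_fm (Suc m) n \<phi>1 \<and> closed_fm (Suc m) n \<phi>2 \<and>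
     closed_fm (Suc (Suc m)) n \<psi>1 \<and> closed_fm (Suc (Suc m)) n \<psi>2 \<and>
     closed_fm (Suc (Suc m)) n \<rho> \<and>
     closed_fm m (Suc n) \<Theta>"

definition sentence :: "('f, 'p) fm \<Rightarrow> bool" where
  "sentence \<phi> \<longleftrightarrow> closed_fm 0 0 \<phi>"

primrec val :: "('f, 'p, 'a) struct \<Rightarrow> (nat \<Rightarrow> 'a) \<Rightarrow> 'f tm \<Rightarrow> 'a" where
  "val M e (Var i) = e i"
| "val M e (Fn f ts) = fun_int M f (map (val M e) ts)"

text \<open>
  \<open>e\<close> assigns elements to first-order variables and \<open>s\<close> assigns sets to branch variables;
  \<open>case_nat a e\<close> pushes the value \<open>a\<close> onto \<open>e\<close> at index 0.
\<close>

primrec sat ::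
  "('f, 'p, 'a) struct \<Rightarrow> (nat \<Rightarrow> 'a) \<Rightarrow> (nat \<Rightarrow> 'a set) \<Rightarrow> ('f, 'p) fm \<Rightarrow> bool" where
  "sat M e s (Eq t u) \<longleftrightarrow> val M e t = val M e u"
| "sat M e s (Rel p ts) \<longleftrightarrow> rel_int M p (map (val M e) ts)"
| "sat M e s (InBr i t) \<longleftrightarrow> val M e t \<in> s i"
| "sat M e s (Neg \<phi>) \<longleftrightarrow> \<not> sat M e s \<phi>"
| "sat M e s (And \<phi> \<psi>) \<longleftrightarrow> sat M e s \<phi> \<and> sat M e s \<psi>"
| "sat M e s (Ex \<phi>) \<longleftrightarrow> (\<exists>a\<in>univ M. sat M (case_nat a e) s \<phi>)"
| "sat M e s (QBrch \<phi>1 \<phi>2 \<psi>1 \<psi>2 \<rho> \<Theta>) \<longleftrightarrow>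
     (let U = {a \<in> univ M. sat M (case_nat a e) s \<phi>1};
          V = {a \<in> univ M. sat M (case_nat a e) s \<phi>2};
          lt1 = {(a, c) \<in> univ M \<times> univ M. sat M (case_nat a (case_nat c e)) s \<psi>1};
          lt2 = {(a, c) \<in> univ M \<times> univ M. sat M (case_nat a (case_nat c e)) s \<psi>2};
          R = {(a, c) \<in> univ M \<times> univ M. sat M (case_nat a (case_nat c e)) s \<rho>}
      in level_tree U V lt1 lt2 R \<longrightarrow>
           (\<exists>b. branch U V lt1 lt2 R b \<and> sat M e (case_nat b s) \<Theta>))"

text \<open>For sentences the choice of the assignments \<open>e\<close> and \<open>s\<close> is immaterial.\<close>

definition is_model :: "('f, 'p, 'a) struct \<Rightarrow> ('f, 'p) fm set \<Rightarrow> bool" where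
  "is_model M T \<longleftrightarrow>
     is_struct M \<and> (\<forall>\<phi>\<in>T. \<forall>e s. range e \<subseteq> univ M \<longrightarrow> sat M e s \<phi>)"

text \<open>
  HOL cannot quantify over types inside a formula, so the type in which a model lives has to be
  named. As universes are arbitrary nonempty subsets of that type, a type variable \<open>'a\<close> in a
  hypothesis loses no generality: any family of models, one for each finite subset of a theory,
  can be copied into a single sufficiently large type. A compactness statement must name a
  concrete type for its conclusion; \<open>('f, 'p) fm set\<close> is large enough, since its cardinality
  is at least the successor of the (infinite) number of formulas.

  A theory all of whose models are finite cannot have a model of infinite cardinality, so the
  spectrum statement is about theories consistent with the universe being infinite, that is,
  theories with an infinite model.
\<close>

end

theory Submission
  imports Defs "HOL-Library.Countable_Set"
begin

text \<open>
  The model is an iterated ultrapower along \<open>\<omega>\<^sub>1\<close>. For each structure \<open>M S\<close> fix an ultrafilter \<open>D S\<close>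
  on the finite subsets of its universe that is fine, i.e. contains the set of all \<open>X\<close> with \<open>a \<in> X\<close>,
  for every \<open>a\<close>. A generic point is a sequence \<open>x i\<close>, \<open>i < \<omega>\<^sub>1\<close>, of such subsets, each generic over the
  earlier ones. The elements of the model are functions of finitely many of the \<open>x i\<close>, taken from a
  family of functions that contains Skolem functions and is closed under quantification over generic
  coordinates; as the family is generated by at most \<open>\<kappa>\<close> operations, cardinalities stay under control.
  Fineness makes an upper bound \<open>level_ub i\<close> of the levels in \<open>x i\<close> bound every level that depends on
  coordinates before \<open>i\<close>.

  Every branch of the resulting model is definable. Choose \<open>t i\<close> in the branch whose level is not below
  \<open>level_ub i\<close>. Up to passing to unboundedly many \<open>i\<close>, the coordinates of \<open>t i\<close> that do not exceed \<open>i\<close> form a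
  fixed finite set \<open>s\<close>. Fix one such node \<open>g\<close>; by indiscernibility all
  nodes obtained from \<open>g\<close> by moving its coordinates outside \<open>s\<close> further up lie on the branch as well,
  so the branch consists of the nodes below \<open>g\<close> when these coordinates are generic. Los's theorem
  then extends to the branch quantifier, with branch variables ranging over definable branches.
  Compactness comes from a family \<open>M\<close> indexed by the finite subsets of the theory, arbitrarily large
  models from \<open>\<kappa>\<close> generic constants in an infinite model.
\<close>

subsection \<open>Ultrafilters\<close>

definition ultra :: "'a filter \<Rightarrow> bool" where
  "ultra F \<longleftrightarrow> F \<noteq> bot \<and> (\<forall>P. eventually P F \<or> eventually (\<lambda>x. \<not> P x) F)"

lemma ultra_not:
  assumes "ultra F"
  shows "eventually (\<lambda>x. \<not> P x) F \<longleftrightarrow> \<not> eventually P F"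
proof
  assume "eventually (\<lambda>x. \<not> P x) F"
  show "\<not> eventually P F"
  proof
    assume "eventually P F"
    with \<open>eventually (\<lambda>x. \<not> P x) F\<close> have "eventually (\<lambda>x. False) F"
      by eventually_elim simp
    with assms show False by (simp add: ultra_def trivial_limit_def)
  qed
qed (use assms in \<open>auto simp: ultra_def\<close>)

lemma ultra_or:
  assumes "ultra F"
  shows "eventually (\<lambda>x. P x \<or> Q x) F \<longleftrightarrow> eventually P F \<or> eventually Q F"
proof -
  have "\<not> eventually (\<lambda>x. \<not> P x \<and> \<not> Q x) F \<longleftrightarrow> eventually P F \<or> eventually Q F"
    by (simp add: eventually_conj_iff ultra_not[OF assms])
  then show ?thesis using ultra_not[OF assms, of "\<lambda>x. \<not> P x \<and> \<not> Q x"] by simp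
qed

lemma ultra_const: "ultra F \<Longrightarrow> eventually (\<lambda>x. P) F \<longleftrightarrow> P"
  by (simp add: ultra_def eventually_const)

text \<open>Zorn's lemma for proper filters, where finer counts as larger. The infimum of a nonempty
  chain is proper because whatever holds eventually in it already holds eventually in some
  member.\<close>

lemma ex_ultra_le:
  fixes F :: "'a filter"
  assumes "F \<noteq> bot"
  shows "\<exists>U. U \<le> F \<and> ultra U"
proof -
  let ?A = "{G. G \<le> F \<and> G \<noteq> bot}"
  let ?P = "\<lambda>x y :: 'a filter. y \<le> x"
  have "\<exists>m\<in>?A. \<forall>a\<in>?A. ?P m a \<longrightarrow> a = m"
  proof (rule predicate_Zorn)
    show "partial_order_on ?A (relation_of ?P ?A)"
      by (rule partial_order_on_relation_ofI) auto
  next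
    fix C assume C: "C \<in> Chains (relation_of ?P ?A)"
    show "\<exists>u\<in>?A. \<forall>a\<in>C. ?P a u"
    proof (cases "C = {}")
      case False
      have CA: "C \<subseteq> ?A" using C by (auto simp: Chains_def relation_of_def)
      have "eventually (\<lambda>x. False) (Inf C) \<longleftrightarrow> (\<exists>b\<in>C. eventually (\<lambda>x. False) b)"
      proof (rule eventually_Inf_base)
        fix G H assume "G \<in> C" "H \<in> C"
        then have "G \<le> H \<or> H \<le> G" using C by (auto simp: Chains_def relation_of_def)
        with \<open>G \<in> C\<close> \<open>H \<in> C\<close> show "\<exists>x\<in>C. x \<le> inf G H"
          by (auto intro: bexI[of _ G] bexI[of _ H])
      qed fact
      then have "Inf C \<noteq> bot" using CA by (auto simp: trivial_limit_def)
      moreover obtain G where "G \<in> C" using False by auto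
      then have "Inf C \<le> G" "G \<le> F" using CA by (auto intro: Inf_lower)
      then have "Inf C \<le> F" by (rule order_trans)
      ultimately have "Inf C \<in> ?A" by simp
      then show ?thesis by (rule bexI[rotated]) (simp add: Inf_lower)
    qed (use assms in auto)
  qed
  then obtain U where U: "U \<le> F" "U \<noteq> bot" and max: "\<And>G. G \<le> F \<Longrightarrow> G \<noteq> bot \<Longrightarrow> G \<le> U \<Longrightarrow> G = U"
    by auto
  \<comment> \<open>Adjoining \<open>P\<close> to \<open>U\<close> keeps the filter proper, so by
    minimality it yields \<open>U\<close> again.\<close>
  have "eventually P U" if "\<not> eventually (\<lambda>x. \<not> P x) U" for P
  proof -
    have "inf U (principal {x. P x}) \<noteq> bot"
      using that by (auto simp: trivial_limit_def eventually_inf_principal)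
    then have "inf U (principal {x. P x}) = U"
      using U(1) by (intro max) (auto intro: le_infI1)
    moreover have "eventually P (inf U (principal {x. P x}))"
      by (simp add: eventually_inf_principal)
    ultimately show ?thesis by simp
  qed
  then show ?thesis using U unfolding ultra_def by blast
qed

definition ultra_below :: "'a filter \<Rightarrow> 'a filter" where
  "ultra_below F = (SOME U. U \<le> F \<and> ultra U)"

lemma ultra_below:
  assumes "F \<noteq> bot"
  shows "ultra_below F \<le> F" "ultra (ultra_below F)"
  using someI_ex[OF ex_ultra_le[OF assms]] unfolding ultra_below_def by auto

subsection \<open>Iterated ultrafilters\<close>

text \<open>The Fubini product of the quantifiers "for \<open>D\<close>-almost all", with the head
  of the list outermost. Coordinates outside the list keep their values from
  \<open>x\<close>.\<close>

primrec iterev :: "'b filter \<Rightarrow> 'i list \<Rightarrow> (('i \<Rightarrow> 'b) \<Rightarrow> bool) \<Rightarrow> ('i \<Rightarrow> 'b) \<Rightarrow> bool" where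
  "iterev D [] P x = P x"
| "iterev D (i # l) P x = eventually (\<lambda>y. iterev D l P (x(i := y))) D"

lemma iterev_append: "iterev D (l @ l') P x = iterev D l (iterev D l' P) x"
  by (induction l arbitrary: x) auto

lemma iterev_mono:
  "iterev D l P x \<Longrightarrow> (\<And>x. P x \<Longrightarrow> Q x) \<Longrightarrow> iterev D l Q x"
  by (induction l arbitrary: x) (auto elim: eventually_mono)

lemma iterev_conj:
  "iterev D l (\<lambda>x. P x \<and> Q x) x \<longleftrightarrow> iterev D l P x \<and> iterev D l Q x"
  by (induction l arbitrary: x) (auto simp: eventually_conj_iff)

lemma iterev_not:
  "ultra D \<Longrightarrow> iterev D l (\<lambda>x. \<not> P x) x \<longleftrightarrow> \<not> iterev D l P x"
  by (induction l arbitrary: x) (auto simp: ultra_not)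

lemma iterev_const: "ultra D \<Longrightarrow> iterev D l (\<lambda>x. c) x = c"
  by (induction l arbitrary: x) (auto simp: ultra_const)

text \<open>Induction on \<open>l\<close> with \<open>y\<close> varying: \<open>y\<close> records
  the coordinates that \<open>P'\<close> may see but that are not quantified, so \<open>P\<close>
  and \<open>P'\<close> need to correspond only at points with these values. Injectivity on
  \<open>A\<close> keeps an update from touching a second coordinate.\<close>

lemma iterev_rename:
  assumes "\<And>x x'. \<lbrakk>\<forall>i\<in>A. x i = x' (\<pi> i); \<forall>i. i \<notin> \<pi> ` set l \<longrightarrow> x' i = y i\<rbrakk> \<Longrightarrow> P x = P' x'"
    and "inj_on \<pi> A" "set l \<subseteq> A"
    and "\<forall>i\<in>A - set l. x i = x' (\<pi> i)" "\<forall>i. i \<notin> \<pi> ` set l \<longrightarrow> x' i = y i"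
  shows "iterev D l P x = iterev D (map \<pi> l) P' x'"
  using assms
proof (induction l arbitrary: x x' y)
  case (Cons i l)
  have "iterev D l P (x(i := z)) = iterev D (map \<pi> l) P' (x'(\<pi> i := z))" for z
  proof (rule Cons.IH[where y = "x'(\<pi> i := z)"])
    show "P u = P' u'" if "\<forall>i\<in>A. u i = u' (\<pi> i)" "\<forall>j. j \<notin> \<pi> ` set l \<longrightarrow> u' j = (x'(\<pi> i := z)) j" for u u'
    proof (rule Cons.prems(1)[OF that(1)], intro allI impI)
      fix j assume "j \<notin> \<pi> ` set (i # l)"
      then have "j \<notin> \<pi> ` set l" "j \<noteq> \<pi> i" by simp_all
      then show "u' j = y j" using that(2) Cons.prems(5) \<open>j \<notin> \<pi> ` set (i # l)\<close> by simp
    qed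
    show "inj_on \<pi> A" "set l \<subseteq> A" using Cons.prems by auto
    show "\<forall>j\<in>A - set l. (x(i := z)) j = (x'(\<pi> i := z)) (\<pi> j)"
    proof
      fix j assume j: "j \<in> A - set l"
      show "(x(i := z)) j = (x'(\<pi> i := z)) (\<pi> j)"
      proof (cases "j = i")
        case False
        then have "\<pi> j \<noteq> \<pi> i" using j Cons.prems(2,3) by (auto dest: inj_onD)
        then show ?thesis using False j Cons.prems(4) by simp
      qed simp
    qed
  qed simp
  then show ?case by simp
next
  case Nil
  show ?case using Nil.prems(1)[of x x'] Nil.prems(4,5) by simp
qed

lemma iterev_cong:
  assumes "\<And>x x'. \<forall>i\<in>A. x i = x' i \<Longrightarrow> P x = P x'" and "set l \<subseteq> A" and "\<forall>i\<in>A - set l. x i = x' i"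
  shows "iterev D l P x = iterev D l P x'"
  using iterev_rename[of A id l x' P P x x' D] assms by simp

text \<open>A quantifier over a coordinate outside the support ranges over a constant predicate,
  hence disappears.\<close>

lemma iterev_filter:
  assumes "ultra D" and P: "\<And>x x'. \<forall>i\<in>A. x i = x' i \<Longrightarrow> P x = P x'"
  shows "iterev D l P x = iterev D (filter (\<lambda>i. i \<in> A) l) P x"
proof (induction l arbitrary: x)
  case (Cons i l)
  show ?case
  proof (cases "i \<in> A")
    case False
    have "iterev D (filter (\<lambda>i. i \<in> A) l) P (x(i := z)) = iterev D (filter (\<lambda>i. i \<in> A) l) P x" for z
      by (rule iterev_cong[OF P]) (use False in auto)
    then show ?thesis using False assms(1) by (simp add: Cons.IH ultra_const del: fun_upd_apply)
  qed (use Cons in \<open>simp del: fun_upd_apply\<close>)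
qed simp

text \<open>
  \<open>iterev\<close> quantifies over the smallest index outermost, so that larger coordinates are generic over
  smaller ones. Taking the limit over all finite index sets along an ultrafilter gives an ultrafilter
  on all points, in particular without a restriction to predicates of finite support.
\<close>

definition iter_filter :: "'s filter \<Rightarrow> ('s \<Rightarrow> 'b filter) \<Rightarrow> ('s \<times> ('i :: linorder \<Rightarrow> 'b)) filter" where
  "iter_filter E D = Abs_filter (\<lambda>P.
     eventually (\<lambda>A. eventually (\<lambda>S. iterev (D S) (sorted_list_of_set A) (\<lambda>x. P (S, x)) (\<lambda>_. undefined)) E)
       (ultra_below (finite_subsets_at_top UNIV)))"

definition depends :: "'i set \<Rightarrow> ('s \<times> ('i \<Rightarrow> 'b) \<Rightarrow> 'c) \<Rightarrow> bool" where
  "depends A f \<longleftrightarrow> (\<forall>S x x'. (\<forall>i\<in>A. x i = x' i) \<longrightarrow> f (S, x) = f (S, x'))"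

context
  fixes E :: "'s filter" and D :: "'s \<Rightarrow> 'b filter"
  assumes E: "ultra E" and D: "\<And>S. ultra (D S)"
begin

lemma eventually_iter_filter:
  "eventually P (iter_filter E D :: ('s \<times> ('i :: linorder \<Rightarrow> 'b)) filter) \<longleftrightarrow>
     eventually (\<lambda>A. eventually (\<lambda>S. iterev (D S) (sorted_list_of_set A) (\<lambda>x. P (S, x)) (\<lambda>_. undefined)) E)
       (ultra_below (finite_subsets_at_top UNIV))"
  unfolding iter_filter_def
proof (rule eventually_Abs_filter, rule is_filter.intro)
qed (auto simp: iterev_const[OF D] iterev_conj eventually_conj_iff elim!: eventually_mono iterev_mono)

lemma ultra_iter_filter: "ultra (iter_filter E D :: ('s \<times> ('i :: linorder \<Rightarrow> 'b)) filter)"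
proof -
  note u = ultra_below(2)[OF finite_subsets_at_top_neq_bot]
  show ?thesis
    unfolding ultra_def trivial_limit_def eventually_iter_filter
    by (auto simp: iterev_const[OF D] ultra_const[OF u] ultra_const[OF E]
          iterev_not[OF D] ultra_not[OF E] ultra_not[OF u])
qed

text \<open>Once a finite index set contains the support \<open>A\<close>, the additional
  quantifiers are vacuous, so the truth value is constant from \<open>A\<close> on and the limit
  over index sets equals its value at \<open>A\<close>.\<close>

lemma eventually_iter_filter_depends:
  fixes P :: "'s \<times> ('i :: linorder \<Rightarrow> 'b) \<Rightarrow> bool"
  assumes "finite A" "depends A P"
  shows "eventually P (iter_filter E D) \<longleftrightarrow>
    eventually (\<lambda>S. iterev (D S) (sorted_list_of_set A) (\<lambda>x. P (S, x)) (\<lambda>_. undefined)) E"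
proof -
  let ?F = "finite_subsets_at_top UNIV :: 'i set filter"
  let ?Q = "\<lambda>A. eventually (\<lambda>S. iterev (D S) (sorted_list_of_set A) (\<lambda>x. P (S, x)) (\<lambda>_. undefined)) E"
  have u: "ultra (ultra_below ?F)" and le: "ultra_below ?F \<le> ?F"
    by (simp_all add: ultra_below)
  have QA: "?Q B \<longleftrightarrow> ?Q A" if "finite B" "A \<subseteq> B" for B
  proof -
    have "filter (\<lambda>i. i \<in> A) (sorted_list_of_set B) = sorted_list_of_set A"
      by (rule sorted_distinct_set_unique)
        (use that \<open>finite A\<close> in \<open>auto intro: sorted_wrt_filter\<close>)
    then have "iterev (D S) (sorted_list_of_set B) (\<lambda>x. P (S, x)) z
        = iterev (D S) (sorted_list_of_set A) (\<lambda>x. P (S, x)) z" for S z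
      using iterev_filter[OF D[of S], of A "\<lambda>x. P (S, x)" "sorted_list_of_set B" z] assms(2)
      by (simp add: depends_def)
    then show ?thesis by simp
  qed
  have "eventually (\<lambda>B. ?Q B \<longleftrightarrow> ?Q A) ?F"
    unfolding eventually_finite_subsets_at_top
    by (rule exI[of _ A], intro conjI allI impI QA) (use \<open>finite A\<close> in auto)
  then have "eventually (\<lambda>B. ?Q B \<longleftrightarrow> ?Q A) (ultra_below ?F)"
    using le by (rule filter_leD[rotated])
  then have "eventually ?Q (ultra_below ?F) \<longleftrightarrow> eventually (\<lambda>B. ?Q A) (ultra_below ?F)"
    by (rule eventually_subst)
  then show ?thesis by (simp add: eventually_iter_filter ultra_const[OF u])
qed

end


subsection \<open>The first uncountable ordinal\<close>

text \<open>The type \<open>nat suc\<close> has the order type \<open>\<omega>\<^sub>1\<close>.\<close>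

lemma Card_order_suc: "Card_order (card_suc |UNIV :: 'a set| )"
  by (rule Card_order_card_suc) (rule card_of_card_order_on)

lemma Field_suc: "Field (card_suc |UNIV :: 'a set| ) = (UNIV :: 'a suc set)"
  by (rule Field_card_suc)

instantiation suc :: (type) linorder
begin

definition less_eq_suc :: "'a suc \<Rightarrow> 'a suc \<Rightarrow> bool" where
  "less_eq_suc a b \<longleftrightarrow> (a, b) \<in> card_suc |UNIV :: 'a set|"

definition less_suc :: "'a suc \<Rightarrow> 'a suc \<Rightarrow> bool" where
  "less_suc a b \<longleftrightarrow> a \<le> b \<and> a \<noteq> b"

instance
proof -
  have "well_order_on (UNIV :: 'a suc set) (card_suc |UNIV :: 'a set| )"
    using Card_order_suc[where 'a = 'a] unfolding card_order_on_def Field_suc by simp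
  then have "refl (card_suc |UNIV :: 'a set| )" "trans (card_suc |UNIV :: 'a set| )"
    "antisym (card_suc |UNIV :: 'a set| )" "total (card_suc |UNIV :: 'a set| )"
    by (auto simp: well_order_on_def linear_order_on_def partial_order_on_def preorder_on_def)
  then show "OFCLASS('a suc, linorder_class)"
    by intro_classes
      (simp_all add: less_eq_suc_def less_suc_def refl_on_def total_on_def,
        (metis antisymD transD)+)
qed

end

lemma card_nat: "|UNIV :: nat set| =o natLeq"
  using card_of_Field_natLeq by (simp add: Field_natLeq)

lemma countable_le_natLeq: "countable A \<longleftrightarrow> |A| \<le>o natLeq"
proof -
  have "|A| \<le>o natLeq \<longleftrightarrow> |A| \<le>o |UNIV :: nat set|"
    using card_nat by (meson ordIso_symmetric ordLeq_ordIso_trans)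
  then show ?thesis by (simp add: countable_def card_of_ordLeq[symmetric])
qed

lemma suc_nat_less: "|A| <o card_suc |UNIV :: nat set| \<longleftrightarrow> countable A"
proof -
  have 1: "cardSuc natLeq =o card_suc |UNIV :: nat set|"
  proof -
    have "cardSuc |UNIV :: nat set| =o card_suc |UNIV :: nat set|"
      by (rule cardSuc_ordIso_card_suc) (rule card_of_card_order_on)
    moreover have "cardSuc natLeq =o cardSuc |UNIV :: nat set|"
      using card_nat cardSuc_invar_ordIso[OF natLeq_Card_order card_of_Card_order]
      by (blast intro: ordIso_symmetric)
    ultimately show ?thesis by (rule ordIso_transitive[rotated])
  qed
  have "|A| <o card_suc |UNIV :: nat set| \<longleftrightarrow> |A| <o cardSuc natLeq"
    using 1 by (meson ordIso_symmetric ordLess_ordIso_trans)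
  also have "\<dots> \<longleftrightarrow> |A| \<le>o natLeq"
    by (rule cardSuc_ordLeq_ordLess[OF natLeq_Card_order card_of_Card_order])
  finally show ?thesis by (simp add: countable_le_natLeq)
qed

lemma countable_atMost_suc: "countable {.. a :: nat suc}"
proof -
  have "{.. a} = insert a (underS (card_suc |UNIV :: nat set| ) a)"
    using order_refl[of a] by (auto simp: underS_def less_eq_suc_def)
  moreover have "|underS (card_suc |UNIV :: nat set| ) a| <o card_suc |UNIV :: nat set|"
    by (rule card_of_underS[OF Card_order_suc]) (simp add: Field_suc)
  ultimately show ?thesis by (simp add: suc_nat_less)
qed

lemma ex_greater_suc: "\<exists>b. (a :: nat suc) < b"
proof -
  have "infinite (UNIV :: nat suc set)"
    using suc_nat_less[of "UNIV :: nat suc set"] Card_order_suc[where 'a = nat]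
    by (metis Field_suc card_of_Field_ordIso countable_finite not_ordLess_ordIso)
  then show ?thesis
    using infinite_Card_order_limit[OF Card_order_suc[where 'a = nat], of a]
    by (auto simp: Field_suc less_suc_def less_eq_suc_def)
qed

text \<open>Regularity of \<open>\<omega>\<^sub>1\<close>: an unbounded set is cofinal and therefore
  as large as \<open>\<omega>\<^sub>1\<close> itself.\<close>

lemma countable_bounded_suc:
  assumes "countable (X :: nat suc set)"
  shows "\<exists>b. \<forall>a\<in>X. a < b"
proof (rule ccontr)
  let ?r = "card_suc |UNIV :: nat set|"
  assume "\<not> ?thesis"
  then have unb: "\<exists>a\<in>X. b \<le> a" for b by (meson not_less)
  have "cofinal X ?r"
    unfolding cofinal_def Field_suc
  proof
    fix a :: "nat suc"
    obtain b where "a < b" using ex_greater_suc by blast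
    moreover obtain c where "c \<in> X" "b \<le> c" using unb by blast
    ultimately have "a < c" by simp
    then show "\<exists>c\<in>X. a \<noteq> c \<and> (a, c) \<in> ?r"
      using \<open>c \<in> X\<close> by (auto simp: less_suc_def less_eq_suc_def)
  qed
  have "regularCard ?r"
    by (rule regularCard_card_suc) (auto simp: cinfinite_def card_of_card_order_on card_of_Card_order Field_card_of)
  with \<open>cofinal X ?r\<close> have "|X| =o ?r" by (auto simp: regularCard_def Field_suc)
  moreover have "|X| <o ?r" using assms by (simp add: suc_nat_less)
  ultimately show False by (simp add: not_ordLess_ordIso)
qed

text \<open>
  A pressing-down argument for finite sets: take \<open>s\<close> of maximal size among the sets that are contained
  in \<open>\<sigma> j\<close> for unboundedly many \<open>j\<close> with \<open>card (\<sigma> j) = n\<close>.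
\<close>

lemma finite_supports_root:
  fixes \<sigma> :: "nat suc \<Rightarrow> nat suc set"
  assumes fin: "\<And>j. finite (\<sigma> j)"
  shows "\<exists>s. finite s \<and> (\<forall>i. \<exists>j\<ge>i. \<sigma> j \<inter> {..i} \<subseteq> s)"
proof -
  \<comment> \<open>Otherwise each size \<open>n\<close> occurs only before some \<open>f n\<close>,
    and a common bound of these countably many ordinals leaves no possible size.\<close>
  have "\<exists>n. \<forall>i. \<exists>j\<ge>i. card (\<sigma> j) = n"
  proof (rule ccontr)
    assume "\<not> ?thesis"
    then obtain f where f: "\<And>n j. j \<ge> f n \<Longrightarrow> card (\<sigma> j) \<noteq> n" by metis
    obtain b where "\<forall>a\<in>range f. a < b" using countable_bounded_suc[of "range f"] by auto
    then show False using f[of "card (\<sigma> b)" b] by (auto intro: less_imp_le)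
  qed
  then obtain n where n: "\<And>i. \<exists>j\<ge>i. card (\<sigma> j) = n" by blast
  define good where "good s \<longleftrightarrow> (\<forall>i. \<exists>j\<ge>i. card (\<sigma> j) = n \<and> s \<subseteq> \<sigma> j)" for s
  have bound: "finite s \<and> card s \<le> n" if s: "good s" for s
  proof -
    obtain j where "card (\<sigma> j) = n" "s \<subseteq> \<sigma> j" using s unfolding good_def by blast
    then show ?thesis using fin card_mono finite_subset by metis
  qed
  have "good {}" using n by (simp add: good_def)
  then obtain s where s: "good s" "\<And>s'. good s' \<Longrightarrow> card s' \<le> card s"
    using Lattices_Big.ex_has_greatest_nat[of good "{}" card "Suc n"] bound less_Suc_eq_le by auto
  have "\<exists>j\<ge>i. \<sigma> j \<inter> {..i} \<subseteq> s" for i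
  proof (rule ccontr)
    assume *: "\<not> ?thesis"
    \<comment> \<open>By maximality of \<open>s\<close>, each of the countably many new elements
      \<open>a\<close> can be added to \<open>s\<close> only at stages before some
      \<open>f a\<close>; beyond a common bound no new element remains.\<close>
    have "\<not> good (insert a s)" if "a \<in> {..i} - s" for a
      using s(2)[of "insert a s"] that bound[OF s(1)] by auto
    then obtain f where f: "\<And>a j. a \<in> {..i} - s \<Longrightarrow> j \<ge> f a \<Longrightarrow> card (\<sigma> j) = n \<Longrightarrow> \<not> insert a s \<subseteq> \<sigma> j"
      unfolding good_def by metis
    have "countable (insert i (f ` ({..i} - s)))" using countable_atMost_suc by auto
    then obtain b where b: "i < b" "\<And>a. a \<in> {..i} - s \<Longrightarrow> f a < b"
      using countable_bounded_suc by (metis (no_types, lifting) image_eqI insertCI)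
    obtain j where j: "j \<ge> b" "card (\<sigma> j) = n" "s \<subseteq> \<sigma> j" using s(1) unfolding good_def by blast
    have "\<not> \<sigma> j \<inter> {..i} \<subseteq> s" using * b(1) j(1) by (meson less_imp_le order_trans)
    then obtain a where "a \<in> \<sigma> j" "a \<le> i" "a \<notin> s" by auto
    moreover from this have "f a < b" using b(2) by simp
    then have "f a \<le> j" using j(1) by (meson less_imp_le order_trans)
    ultimately show False using f[of a j] j by simp
  qed
  then show ?thesis using bound[OF s(1)] by blast
qed

text \<open>Gives room to move finitely many generic coordinates past any ordinal: each new largest
  element is sent above \<open>i\<close> and all earlier images.\<close>

lemma ex_strict_mono_above:
  fixes r :: "'i :: linorder set" and i :: "nat suc"
  assumes "finite r"
  shows "\<exists>\<pi>. strict_mono_on r \<pi> \<and> (\<forall>a\<in>r. i < \<pi> a)"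
  using assms
proof (induction r rule: finite_linorder_max_induct)
  case (insert b r)
  then obtain \<pi> where \<pi>: "strict_mono_on r \<pi>" "\<forall>a\<in>r. i < \<pi> a" by blast
  have "countable (insert i (\<pi> ` r))" using insert by (simp add: countable_finite)
  from countable_bounded_suc[OF this] obtain c where "\<forall>a\<in>insert i (\<pi> ` r). a < c" by auto
  with \<pi> insert.hyps have "strict_mono_on (insert b r) (\<pi>(b := c)) \<and> (\<forall>a\<in>insert b r. i < (\<pi>(b := c)) a)"
    by (force simp: strict_mono_on_def)
  then show ?case by blast
qed simp


subsection \<open>Genericity and indiscernibility\<close>

lemma sorted_list_of_set_append:
  assumes "finite A" "finite B" "\<And>a b. a \<in> A \<Longrightarrow> b \<in> B \<Longrightarrow> a < b"
  shows "sorted_list_of_set (A \<union> B) = sorted_list_of_set A @ sorted_list_of_set B"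
  using assms by (intro sorted_distinct_set_unique) (auto simp: sorted_append intro: less_imp_le)

lemma sorted_list_of_set_image:
  assumes "finite A" "strict_mono_on A \<pi>"
  shows "sorted_list_of_set (\<pi> ` A) = map \<pi> (sorted_list_of_set A)"
proof (rule sorted_distinct_set_unique)
  have "mono_on A \<pi>" using assms(2) by (rule strict_mono_on_imp_mono_on)
  then show "sorted (map \<pi> (sorted_list_of_set A))"
    using assms(1) by (auto simp: sorted_wrt_map mono_on_def intro!: sorted_wrt_mono_rel[OF _ sorted_sorted_list_of_set])
  show "distinct (map \<pi> (sorted_list_of_set A))"
    using assms by (simp add: distinct_map strict_mono_on_imp_inj_on)
qed (use assms in auto)

lemma depends_mono: "depends A f \<Longrightarrow> A \<subseteq> B \<Longrightarrow> depends B f"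
  unfolding depends_def by blast

context
  fixes E :: "'s filter" and D :: "'s \<Rightarrow> 'b filter"
  assumes E: "ultra E" and D: "\<And>S. ultra (D S)"
begin

text \<open>The largest coordinate is quantified innermost, so a property that holds for almost
  every value of it, whatever the others are, survives the outer quantifiers.\<close>

lemma eventually_iter_filter_last:
  fixes P :: "'s \<times> ('i :: linorder \<Rightarrow> 'b) \<Rightarrow> bool"
  assumes "finite A" "\<And>a. a \<in> A \<Longrightarrow> a < i" "depends (insert i A) P"
    and P: "\<And>S x. eventually (\<lambda>y. P (S, x(i := y))) (D S)"
  shows "eventually P (iter_filter E D)"
proof -
  have "sorted_list_of_set (insert i A) = sorted_list_of_set A @ [i]"
    using sorted_list_of_set_append[of A "{i}"] assms(1,2) by simp
  moreover have "iterev (D S) l (iterev (D S) [i] (\<lambda>x. P (S, x))) z" for S l z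
  proof (rule iterev_mono)
    show "iterev (D S) l (\<lambda>_. True) z" by (subst iterev_const[OF D]) (rule TrueI)
  qed (use P in auto)
  ultimately show ?thesis
    using assms(1,3) by (simp add: eventually_iter_filter_depends[OF E D, of "insert i A"] iterev_append)
qed

text \<open>Indiscernibility of the generic coordinates: an increasing map takes the sorted list of
  the support to the sorted list of its image, so the iterated quantifiers correspond one by
  one.\<close>

lemma eventually_iter_filter_rename:
  fixes P :: "'s \<times> ('i :: linorder \<Rightarrow> 'b) \<Rightarrow> bool"
  assumes "finite A" "strict_mono_on A \<pi>" "depends A P"
  shows "eventually (\<lambda>\<omega>. P (fst \<omega>, \<lambda>i. snd \<omega> (\<pi> i))) (iter_filter E D) \<longleftrightarrow> eventually P (iter_filter E D)"
proof -
  let ?P' = "\<lambda>\<omega>. P (fst \<omega>, \<lambda>i. snd \<omega> (\<pi> i))"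
  have "depends (\<pi> ` A) ?P'" using assms(3) by (auto simp: depends_def)
  moreover have "iterev (D S) (sorted_list_of_set A) (\<lambda>x. P (S, x)) (\<lambda>_. undefined)
      = iterev (D S) (map \<pi> (sorted_list_of_set A)) (\<lambda>x. ?P' (S, x)) (\<lambda>_. undefined)" for S
    by (rule iterev_rename[where A = A and y = "\<lambda>_. undefined"])
      (use assms in \<open>auto simp: depends_def strict_mono_on_imp_inj_on\<close>)
  ultimately show ?thesis
    using assms by (simp add: eventually_iter_filter_depends[OF E D, of "\<pi> ` A"]
        eventually_iter_filter_depends[OF E D, of A] sorted_list_of_set_image)
qed

text \<open>Quantifying over generic values at \<open>r\<close> amounts to plugging in actual
  coordinates beyond \<open>C\<close>, since these are generic over everything in \<open>C\<close>.
  The set \<open>r\<close> may meet \<open>C\<close>: the quantifier rebinds coordinates only in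
  \<open>B\<close>, while \<open>f\<close> stays at the original point.\<close>

lemma eventually_iter_filter_quant:
  fixes f :: "'s \<times> ('i :: linorder \<Rightarrow> 'b) \<Rightarrow> 'a" and B :: "'s \<times> ('i \<Rightarrow> 'b) \<Rightarrow> 'a set"
  assumes fin: "finite C" "finite r" and f: "depends C f" and B: "depends (s \<union> r) B" and s: "s \<subseteq> C"
    and \<pi>: "strict_mono_on r \<pi>" "\<And>a c. a \<in> r \<Longrightarrow> c \<in> C \<Longrightarrow> c < \<pi> a"
  shows "eventually (\<lambda>\<omega>. iterev (D (fst \<omega>)) (sorted_list_of_set r) (\<lambda>x. f \<omega> \<in> B (fst \<omega>, x)) (snd \<omega>)) (iter_filter E D)
    \<longleftrightarrow> eventually (\<lambda>\<omega>. f \<omega> \<in> B (fst \<omega>, \<lambda>i. snd \<omega> (if i \<in> r then \<pi> i else i))) (iter_filter E D)"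
    (is "eventually ?P _ \<longleftrightarrow> eventually ?P' _")
proof -
  define \<pi>' where "\<pi>' i = (if i \<in> r then \<pi> i else i)" for i
  let ?l = "sorted_list_of_set r"
  have map: "map \<pi>' ?l = map \<pi> ?l" using fin by (simp add: \<pi>'_def)
  have "depends C ?P"
  proof -
    have "iterev (D S) ?l (\<lambda>u. f (S, x) \<in> B (S, u)) x = iterev (D S) ?l (\<lambda>u. f (S, x') \<in> B (S, u)) x'"
      if "\<forall>i\<in>C. x i = x' i" for S x x'
    proof -
      have "f (S, x) = f (S, x')" using f that by (simp add: depends_def)
      moreover have "iterev (D S) ?l (\<lambda>u. f (S, x') \<in> B (S, u)) x = iterev (D S) ?l (\<lambda>u. f (S, x') \<in> B (S, u)) x'"
      proof (rule iterev_cong[where A = "s \<union> r"])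
        show "(f (S, x') \<in> B (S, u)) = (f (S, x') \<in> B (S, u'))" if "\<forall>i\<in>s \<union> r. u i = u' i" for u u'
          using B that unfolding depends_def by metis
      qed (use fin s that in auto)
      ultimately show ?thesis by simp
    qed
    then show ?thesis by (simp add: depends_def)
  qed
  moreover have "depends (C \<union> \<pi> ` r) ?P'"
    unfolding depends_def
  proof (intro allI impI)
    fix S and x x' :: "'i \<Rightarrow> 'b" assume eq: "\<forall>i\<in>C \<union> \<pi> ` r. x i = x' i"
    have "f (S, x) = f (S, x')" using f eq by (simp add: depends_def)
    moreover have "B (S, \<lambda>i. x (\<pi>' i)) = B (S, \<lambda>i. x' (\<pi>' i))"
      using B eq s unfolding depends_def by (auto simp: \<pi>'_def intro!: B[unfolded depends_def, rule_format])
    ultimately show "?P' (S, x) = ?P' (S, x')" by (simp add: \<pi>'_def)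
  qed
  \<comment> \<open>All of \<open>C\<close> precedes the moved coordinates, which are therefore
    quantified last.\<close>
  moreover have "sorted_list_of_set (C \<union> \<pi> ` r) = sorted_list_of_set C @ map \<pi> ?l"
    using fin \<pi> by (subst sorted_list_of_set_append) (auto simp: sorted_list_of_set_image)
  \<comment> \<open>At a point \<open>x\<close> that gives the values on \<open>C\<close>, the inner
    block over the moved coordinates is the original quantifier over \<open>r\<close> with
    \<open>f\<close> frozen at \<open>x\<close>.\<close>
  moreover have "iterev (D S) (map \<pi> ?l) (\<lambda>x. ?P' (S, x)) = (\<lambda>x. ?P (S, x))" for S
  proof (rule ext)
    fix x
    have "iterev (D S) ?l (\<lambda>u. f (S, x) \<in> B (S, u)) x = iterev (D S) (map \<pi>' ?l) (\<lambda>u. f (S, u) \<in> B (S, \<lambda>i. u (\<pi>' i))) x"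
    proof (rule iterev_rename[where A = "s \<union> r" and y = x])
      fix u u' assume u: "\<forall>i\<in>s \<union> r. u i = u' (\<pi>' i)" "\<forall>i. i \<notin> \<pi>' ` set ?l \<longrightarrow> u' i = x i"
      have "u' i = x i" if "i \<in> C" for i
        using u(2) that \<pi>(2) fin by (force simp: \<pi>'_def)
      then have "f (S, u') = f (S, x)" using f by (simp add: depends_def)
      moreover have "B (S, u) = B (S, \<lambda>i. u' (\<pi>' i))" using B u(1) by (simp add: depends_def)
      ultimately show "(f (S, x) \<in> B (S, u)) = (f (S, u') \<in> B (S, \<lambda>i. u' (\<pi>' i)))" by simp
    next
      have "\<pi> a \<noteq> c" if "a \<in> r" "c \<in> s" for a c using that \<pi>(2)[of a c] s by auto
      moreover have "inj_on \<pi> r" using \<pi>(1) by (rule strict_mono_on_imp_inj_on)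
      ultimately show "inj_on \<pi>' (s \<union> r)"
        by (auto simp: inj_on_def \<pi>'_def)
    qed (use fin in \<open>auto simp: \<pi>'_def\<close>)
    then show "iterev (D S) (map \<pi> ?l) (\<lambda>x. ?P' (S, x)) x = ?P (S, x)"
      unfolding map by (simp add: \<pi>'_def)
  qed
  ultimately show ?thesis
    using fin by (simp add: eventually_iter_filter_depends[OF E D, of C] eventually_iter_filter_depends[OF E D, of "C \<union> \<pi> ` r"] iterev_append)
qed

end


subsection \<open>Level-trees as first-order structures\<close>

record 'a ltree =
  tU :: "'a set"
  tV :: "'a set"
  tL :: "'a rel"
  tM :: "'a rel"
  tR :: "'a rel"
  tB :: "'a set"

text \<open>
  A first-order language with de Bruijn indices for trees with a distinguished set \<open>tB\<close>. It suffices
  to express that something is a level-tree and that \<open>tB\<close> is a branch, so these notions are preserved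
  by the ultrapower.
\<close>

datatype bf =
    BU nat | BV nat | BB nat | BL nat nat | BM nat nat | BR nat nat | BEq nat nat
  | BNeg bf | BAnd bf bf | BEx bf

primrec ev :: "'a set \<Rightarrow> 'a ltree \<Rightarrow> 'a list \<Rightarrow> bf \<Rightarrow> bool" where
  "ev M t e (BU i) \<longleftrightarrow> e ! i \<in> tU t"
| "ev M t e (BV i) \<longleftrightarrow> e ! i \<in> tV t"
| "ev M t e (BB i) \<longleftrightarrow> e ! i \<in> tB t"
| "ev M t e (BL i j) \<longleftrightarrow> (e ! i, e ! j) \<in> tL t"
| "ev M t e (BM i j) \<longleftrightarrow> (e ! i, e ! j) \<in> tM t"
| "ev M t e (BR i j) \<longleftrightarrow> (e ! i, e ! j) \<in> tR t"
| "ev M t e (BEq i j) \<longleftrightarrow> e ! i = e ! j"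
| "ev M t e (BNeg f) \<longleftrightarrow> \<not> ev M t e f"
| "ev M t e (BAnd f g) \<longleftrightarrow> ev M t e f \<and> ev M t e g"
| "ev M t e (BEx f) \<longleftrightarrow> (\<exists>a\<in>M. ev M t (a # e) f)"

primrec closed_bf :: "nat \<Rightarrow> bf \<Rightarrow> bool" where
  "closed_bf n (BU i) \<longleftrightarrow> i < n"
| "closed_bf n (BV i) \<longleftrightarrow> i < n"
| "closed_bf n (BB i) \<longleftrightarrow> i < n"
| "closed_bf n (BL i j) \<longleftrightarrow> i < n \<and> j < n"
| "closed_bf n (BM i j) \<longleftrightarrow> i < n \<and> j < n"
| "closed_bf n (BR i j) \<longleftrightarrow> i < n \<and> j < n"
| "closed_bf n (BEq i j) \<longleftrightarrow> i < n \<and> j < n"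
| "closed_bf n (BNeg f) \<longleftrightarrow> closed_bf n f"
| "closed_bf n (BAnd f g) \<longleftrightarrow> closed_bf n f \<and> closed_bf n g"
| "closed_bf n (BEx f) \<longleftrightarrow> closed_bf (Suc n) f"

definition BAll :: "bf \<Rightarrow> bf" where "BAll f = BNeg (BEx (BNeg f))"
definition BImp :: "bf \<Rightarrow> bf \<Rightarrow> bf" where "BImp f g = BNeg (BAnd f (BNeg g))"
definition BOr :: "bf \<Rightarrow> bf \<Rightarrow> bf" where "BOr f g = BNeg (BAnd (BNeg f) (BNeg g))"

lemma ev_derived [simp]:
  "ev M t e (BAll f) \<longleftrightarrow> (\<forall>a\<in>M. ev M t (a # e) f)"
  "ev M t e (BImp f g) \<longleftrightarrow> (ev M t e f \<longrightarrow> ev M t e g)"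
  "ev M t e (BOr f g) \<longleftrightarrow> ev M t e f \<or> ev M t e g"
  by (auto simp: BAll_def BImp_def BOr_def)

lemma closed_bf_derived [simp]:
  "closed_bf n (BAll f) \<longleftrightarrow> closed_bf (Suc n) f"
  "closed_bf n (BImp f g) \<longleftrightarrow> closed_bf n f \<and> closed_bf n g"
  "closed_bf n (BOr f g) \<longleftrightarrow> closed_bf n f \<and> closed_bf n g"
  by (auto simp: BAll_def BImp_def BOr_def)

text \<open>The conjuncts follow \<open>level_tree\<close> in order; index 0 belongs to the
  innermost quantifier. Unique existence of the level is split into existence and uniqueness.
  Linearity is stated for arbitrary predecessors of a node, which lie in \<open>U\<close> by an
  earlier conjunct.\<close>

definition level_tree_bf :: bf where
  "level_tree_bf =
     BAnd (BEx (BOr (BU 0) (BV 0)))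
    (BAnd (BAll (BAll (BImp (BL 1 0) (BAnd (BU 1) (BU 0)))))
    (BAnd (BAll (BNeg (BL 0 0)))
    (BAnd (BAll (BAll (BAll (BImp (BAnd (BL 2 1) (BL 1 0)) (BL 2 0)))))
    (BAnd (BAll (BAll (BAll (BImp (BAnd (BL 1 2) (BL 0 2)) (BOr (BEq 1 0) (BOr (BL 1 0) (BL 0 1)))))))
    (BAnd (BAll (BAll (BImp (BM 1 0) (BAnd (BV 1) (BV 0)))))
    (BAnd (BAll (BNeg (BM 0 0)))
    (BAnd (BAll (BAll (BAll (BImp (BAnd (BM 2 1) (BM 1 0)) (BM 2 0)))))
    (BAnd (BAll (BAll (BImp (BAnd (BV 1) (BV 0))
       (BEx (BAnd (BV 0) (BAnd (BOr (BEq 2 0) (BM 2 0)) (BOr (BEq 1 0) (BM 1 0))))))))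
    (BAnd (BNeg (BEx (BAnd (BV 0) (BAll (BImp (BV 0) (BOr (BEq 0 1) (BM 0 1)))))))
    (BAnd (BAll (BAll (BImp (BR 1 0) (BAnd (BU 1) (BV 0)))))
    (BAnd (BAll (BImp (BU 0) (BEx (BR 1 0))))
    (BAnd (BAll (BAll (BAll (BImp (BAnd (BR 2 1) (BR 2 0)) (BEq 1 0)))))
          (BAll (BAll (BAll (BAll (BImp (BAnd (BL 3 2) (BAnd (BR 3 1) (BR 2 0))) (BM 1 0))))))))))))))))))"

text \<open>Maximality, a statement about sets, becomes first-order: a node comparable with every
  member of the set belongs to it.\<close>

definition branch_bf :: bf where
  "branch_bf =
     BAnd (BAll (BImp (BB 0) (BU 0)))
    (BAnd (BAll (BAll (BImp (BAnd (BB 1) (BB 0)) (BOr (BEq 1 0) (BOr (BL 1 0) (BL 0 1))))))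
    (BAnd (BAll (BImp (BAnd (BU 0) (BAll (BImp (BB 0) (BOr (BEq 0 1) (BOr (BL 0 1) (BL 1 0)))))) (BB 0)))
          (BNeg (BEx (BAnd (BV 0) (BAll (BAll (BImp (BAnd (BB 1) (BR 1 0)) (BOr (BEq 0 2) (BM 0 2))))))))))"

lemma closed_level_tree_bf: "closed_bf n level_tree_bf"
  and closed_branch_bf: "closed_bf n branch_bf"
  by (simp_all add: level_tree_bf_def branch_bf_def)

definition ltree_in :: "'a set \<Rightarrow> 'a ltree \<Rightarrow> bool" where
  "ltree_in M t \<longleftrightarrow> tU t \<subseteq> M \<and> tV t \<subseteq> M \<and> tL t \<subseteq> M \<times> M \<and> tM t \<subseteq> M \<times> M \<and> tR t \<subseteq> M \<times> M"

abbreviation is_level_tree :: "'a ltree \<Rightarrow> bool" where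
  "is_level_tree t \<equiv> level_tree (tU t) (tV t) (tL t) (tM t) (tR t)"

abbreviation is_branch :: "'a ltree \<Rightarrow> 'a set \<Rightarrow> bool" where
  "is_branch t \<equiv> branch (tU t) (tV t) (tL t) (tM t) (tR t)"

text \<open>All components lie inside \<open>M\<close>, so bounding the quantifiers by
  \<open>M\<close> does not change their meaning.\<close>

lemma ev_level_tree:
  assumes "ltree_in M t"
  shows "ev M t e level_tree_bf \<longleftrightarrow> is_level_tree t"
proof -
  obtain U V L N R B where t: "t = \<lparr>tU = U, tV = V, tL = L, tM = N, tR = R, tB = B\<rparr>" by (cases t)
  have sub: "\<And>a. a \<in> U \<Longrightarrow> a \<in> M" "\<And>a. a \<in> V \<Longrightarrow> a \<in> M"
    "\<And>a b. (a, b) \<in> L \<Longrightarrow> a \<in> M \<and> b \<in> M" "\<And>a b. (a, b) \<in> N \<Longrightarrow> a \<in> M \<and> b \<in> M"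
    "\<And>a b. (a, b) \<in> R \<Longrightarrow> a \<in> M \<and> b \<in> M"
    using assms by (auto simp: ltree_in_def t)
  have subM: "L \<subseteq> M \<times> M" "N \<subseteq> M \<times> M" "R \<subseteq> M \<times> M"
    using assms by (auto simp: ltree_in_def t)
  have ne: "U \<union> V \<noteq> {} \<longleftrightarrow> (\<exists>a\<in>M. a \<in> U \<or> a \<in> V)" using sub by blast
  have rel: "r \<subseteq> A \<times> A' \<longleftrightarrow> (\<forall>a\<in>M. \<forall>b\<in>M. (a, b) \<in> r \<longrightarrow> a \<in> A \<and> b \<in> A')"
    "irrefl r \<longleftrightarrow> (\<forall>a\<in>M. (a, a) \<notin> r)"
    "trans r \<longleftrightarrow> (\<forall>a\<in>M. \<forall>b\<in>M. \<forall>c\<in>M. (a, b) \<in> r \<and> (b, c) \<in> r \<longrightarrow> (a, c) \<in> r)"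
    if "r \<subseteq> M \<times> M" for r A A'
    subgoal by (intro iffI subrelI) (blast, use that in blast)
    subgoal using that unfolding irrefl_def by blast
    subgoal using that unfolding trans_def by blast
    done
  have tot: "(\<forall>u\<in>U. total_on {y \<in> U. (y, u) \<in> L} L) \<longleftrightarrow>
     (\<forall>u\<in>M. \<forall>a\<in>M. \<forall>b\<in>M. (a, u) \<in> L \<and> (b, u) \<in> L \<longrightarrow> a = b \<or> (a, b) \<in> L \<or> (b, a) \<in> L)"
    if L: "L \<subseteq> U \<times> U"
  proof -
    have "total_on {y \<in> U. (y, u) \<in> L} L \<longleftrightarrow>
      (\<forall>a b. (a, u) \<in> L \<and> (b, u) \<in> L \<longrightarrow> a = b \<or> (a, b) \<in> L \<or> (b, a) \<in> L)" for u
      unfolding total_on_def using L by blast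
    moreover have "u \<in> U" if "(a, u) \<in> L" for a u using that L by blast
    ultimately show ?thesis using sub(1,3) by meson
  qed
  have V: "(\<forall>v\<in>V. P v) \<longleftrightarrow> (\<forall>v\<in>M. v \<in> V \<longrightarrow> P v)" "(\<exists>v\<in>V. P v) \<longleftrightarrow> (\<exists>v\<in>M. v \<in> V \<and> P v)" for P
    using sub(2) by blast+
  have dir: "(\<forall>v\<in>V. \<forall>w\<in>V. \<exists>z\<in>V. (v, z) \<in> N\<^sup>= \<and> (w, z) \<in> N\<^sup>=) \<longleftrightarrow>
     (\<forall>v\<in>M. \<forall>w\<in>M. v \<in> V \<and> w \<in> V \<longrightarrow> (\<exists>z\<in>M. z \<in> V \<and> (v = z \<or> (v, z) \<in> N) \<and> (w = z \<or> (w, z) \<in> N)))"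
    by (simp add: V disj_commute) meson
  have last: "(\<exists>z\<in>V. \<forall>v\<in>V. (v, z) \<in> N\<^sup>=) \<longleftrightarrow> (\<exists>z\<in>M. z \<in> V \<and> (\<forall>v\<in>M. v \<in> V \<longrightarrow> v = z \<or> (v, z) \<in> N))"
    by (simp add: V disj_commute)
  have fn: "(\<forall>u\<in>U. \<exists>!v. (u, v) \<in> R) \<longleftrightarrow> (\<forall>u\<in>M. u \<in> U \<longrightarrow> (\<exists>v\<in>M. (u, v) \<in> R)) \<and>
      (\<forall>u\<in>M. \<forall>v\<in>M. \<forall>w\<in>M. (u, v) \<in> R \<and> (u, w) \<in> R \<longrightarrow> v = w)" if R: "R \<subseteq> U \<times> V"
  proof -
    define A where "A u \<longleftrightarrow> (\<exists>v\<in>M. (u, v) \<in> R)" for u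
    define C where "C u \<longleftrightarrow> (\<forall>v\<in>M. \<forall>w\<in>M. (u, v) \<in> R \<and> (u, w) \<in> R \<longrightarrow> v = w)" for u
    have "(\<exists>!v. (u, v) \<in> R) \<longleftrightarrow> A u \<and> C u" for u
      unfolding A_def C_def using sub(5) by blast
    moreover have "C u" if "u \<notin> U" for u using that R unfolding C_def by blast
    ultimately have "(\<forall>u\<in>U. \<exists>!v. (u, v) \<in> R) \<longleftrightarrow> (\<forall>u\<in>M. u \<in> U \<longrightarrow> A u) \<and> (\<forall>u\<in>M. C u)"
      using sub(1) by auto
    then show ?thesis unfolding A_def C_def .
  qed
  have ord: "(\<forall>t u v w. (t, u) \<in> L \<and> (t, v) \<in> R \<and> (u, w) \<in> R \<longrightarrow> (v, w) \<in> N) \<longleftrightarrow>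
     (\<forall>t\<in>M. \<forall>u\<in>M. \<forall>v\<in>M. \<forall>w\<in>M. (t, u) \<in> L \<and> (t, v) \<in> R \<and> (u, w) \<in> R \<longrightarrow> (v, w) \<in> N)"
    using sub(3,5) by meson
  note L = rel(1)[where r = L and A = U and A' = U, OF subM(1)] rel(2)[where r = L, OF subM(1)] rel(3)[where r = L, OF subM(1)]
    and N = rel(1)[where r = N and A = V and A' = V, OF subM(2)] rel(2)[where r = N, OF subM(2)] rel(3)[where r = N, OF subM(2)]
    and R = rel(1)[where r = R and A = U and A' = V, OF subM(3)]
  show ?thesis
  \<comment> \<open>The rewritings \<open>tot\<close> and \<open>fn\<close> presuppose these
    inclusions; if one of them fails, both sides are false.\<close>
  proof (cases "L \<subseteq> U \<times> U \<and> R \<subseteq> U \<times> V")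
    case True
    then have LR: "L \<subseteq> U \<times> U" "R \<subseteq> U \<times> V" by simp_all
    show ?thesis
      unfolding level_tree_def ne dir last ord t ltree.simps tot[OF LR(1)] fn[OF LR(2)] N L(2,3)
      using LR[unfolded L(1) R] LR
      by (simp add: level_tree_bf_def)
  next
    case False
    then have "\<not> is_level_tree t" unfolding level_tree_def t ltree.simps by blast
    moreover have "\<not> ev M t e level_tree_bf"
      using False unfolding L R by (simp add: level_tree_bf_def t) blast
    ultimately show ?thesis by simp
  qed
qed

lemma ev_branch:
  assumes "ltree_in M t" "tB t \<subseteq> M"
  shows "ev M t e branch_bf \<longleftrightarrow> is_branch t (tB t)"
proof -
  obtain U V L N R B where t: "t = \<lparr>tU = U, tV = V, tL = L, tM = N, tR = R, tB = B\<rparr>" by (cases t)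
  have sub: "\<And>a. a \<in> U \<Longrightarrow> a \<in> M" "\<And>a. a \<in> V \<Longrightarrow> a \<in> M" "\<And>a. a \<in> B \<Longrightarrow> a \<in> M"
    "\<And>a b. (a, b) \<in> R \<Longrightarrow> a \<in> M \<and> b \<in> M"
    using assms by (auto simp: ltree_in_def t)
  have BU: "B \<subseteq> U \<longleftrightarrow> (\<forall>a\<in>M. a \<in> B \<longrightarrow> a \<in> U)" using sub by blast
  have tot: "total_on B L \<longleftrightarrow> (\<forall>a\<in>M. \<forall>b\<in>M. a \<in> B \<and> b \<in> B \<longrightarrow> a = b \<or> (a, b) \<in> L \<or> (b, a) \<in> L)"
    using sub unfolding total_on_def by blast
  \<comment> \<open>Any element of a linearly ordered extension of \<open>B\<close> is comparable
    with all of \<open>B\<close>, so maximality can be tested on one-element extensions.\<close>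
  have max: "(\<forall>c. B \<subseteq> c \<and> c \<subseteq> U \<and> total_on c L \<longrightarrow> c = B) \<longleftrightarrow>
     (\<forall>a\<in>M. a \<in> U \<and> (\<forall>b\<in>M. b \<in> B \<longrightarrow> b = a \<or> (b, a) \<in> L \<or> (a, b) \<in> L) \<longrightarrow> a \<in> B)"
    if "B \<subseteq> U" "total_on B L"
  proof (intro iffI allI impI ballI)
    fix a assume max: "\<forall>c. B \<subseteq> c \<and> c \<subseteq> U \<and> total_on c L \<longrightarrow> c = B"
      and a: "a \<in> U \<and> (\<forall>b\<in>M. b \<in> B \<longrightarrow> b = a \<or> (b, a) \<in> L \<or> (a, b) \<in> L)"
    have "total_on (insert a B) L" using that(2) a sub(3) unfolding total_on_def by blast
    then have "insert a B = B" using max a that(1) by blast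
    then show "a \<in> B" by blast
  next
    fix c assume "\<forall>a\<in>M. a \<in> U \<and> (\<forall>b\<in>M. b \<in> B \<longrightarrow> b = a \<or> (b, a) \<in> L \<or> (a, b) \<in> L) \<longrightarrow> a \<in> B"
      "B \<subseteq> c \<and> c \<subseteq> U \<and> total_on c L"
    note * = this
    have "a \<in> B" if "a \<in> c" for a
    proof -
      have "a \<in> U" using * that by blast
      moreover have "b = a \<or> (b, a) \<in> L \<or> (a, b) \<in> L" if "b \<in> B" for b
        using *(2) that \<open>a \<in> c\<close> unfolding total_on_def by blast
      ultimately show ?thesis using *(1) sub(1) by blast
    qed
    with * show "c = B" by blast
  qed
  have unb: "(\<exists>z\<in>V. \<forall>v\<in>R `` B. (v, z) \<in> N\<^sup>=) \<longleftrightarrow>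
     (\<exists>z\<in>M. z \<in> V \<and> (\<forall>a\<in>M. \<forall>v\<in>M. a \<in> B \<and> (a, v) \<in> R \<longrightarrow> v = z \<or> (v, z) \<in> N))"
    using sub by blast
  show ?thesis
  proof (cases "B \<subseteq> U \<and> total_on B L")
    case True
    then have *: "B \<subseteq> U" "total_on B L" by simp_all
    show ?thesis
      unfolding branch_def t ltree.simps max[OF *] unb
      using *[unfolded BU tot] * by (simp add: branch_bf_def)
  next
    case False
    then have "\<not> is_branch t (tB t)" unfolding branch_def t ltree.simps by blast
    moreover have "\<not> ev M t e branch_bf"
      using False unfolding BU tot by (simp add: branch_bf_def t) blast
    ultimately show ?thesis by simp
  qed
qed


subsection \<open>Formulas\<close>

primrec subf :: "('f, 'p) fm \<Rightarrow> ('f, 'p) fm set" where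
  "subf (Eq t u) = {Eq t u}"
| "subf (Rel p ts) = {Rel p ts}"
| "subf (InBr i t) = {InBr i t}"
| "subf (Neg \<phi>) = insert (Neg \<phi>) (subf \<phi>)"
| "subf (And \<phi> \<psi>) = insert (And \<phi> \<psi>) (subf \<phi> \<union> subf \<psi>)"
| "subf (Ex \<phi>) = insert (Ex \<phi>) (subf \<phi>)"
| "subf (QBrch \<phi>1 \<phi>2 \<psi>1 \<psi>2 \<rho> \<Theta>) = insert (QBrch \<phi>1 \<phi>2 \<psi>1 \<psi>2 \<rho> \<Theta>)
     (subf \<phi>1 \<union> subf \<phi>2 \<union> subf \<psi>1 \<union> subf \<psi>2 \<union> subf \<rho> \<union> subf \<Theta>)"

primrec funs_tm :: "'f tm \<Rightarrow> 'f set" where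
  "funs_tm (Var i) = {}"
| "funs_tm (Fn f ts) = insert f (\<Union> (set (map funs_tm ts)))"

primrec funs_fm :: "('f, 'p) fm \<Rightarrow> 'f set" where
  "funs_fm (Eq t u) = funs_tm t \<union> funs_tm u"
| "funs_fm (Rel p ts) = (\<Union>t\<in>set ts. funs_tm t)"
| "funs_fm (InBr i t) = funs_tm t"
| "funs_fm (Neg \<phi>) = funs_fm \<phi>"
| "funs_fm (And \<phi> \<psi>) = funs_fm \<phi> \<union> funs_fm \<psi>"
| "funs_fm (Ex \<phi>) = funs_fm \<phi>"
| "funs_fm (QBrch \<phi>1 \<phi>2 \<psi>1 \<psi>2 \<rho> \<Theta>) =
     funs_fm \<phi>1 \<union> funs_fm \<phi>2 \<union> funs_fm \<psi>1 \<union> funs_fm \<psi>2 \<union> funs_fm \<rho> \<union> funs_fm \<Theta>"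

lemma finite_subf: "finite (subf \<phi>)"
  by (induction \<phi>) auto

lemma finite_funs_tm: "finite (funs_tm t)"
  by (induction t) auto

lemma finite_funs_fm: "finite (funs_fm \<phi>)"
  by (induction \<phi>) (auto simp: finite_funs_tm)

lemma self_in_subf: "\<phi> \<in> subf \<phi>"
  by (cases \<phi>) auto

lemma val_cong: "closed_tm m t \<Longrightarrow> (\<And>i. i < m \<Longrightarrow> e i = e' i) \<Longrightarrow> val M e t = val M e' t"
proof (induction t)
  case (Fn f ts)
  then have "map (val M e) ts = map (val M e') ts" by (auto simp: list_all_iff)
  then show ?case unfolding val.simps by (rule arg_cong)
qed simp

lemma sat_cong:
  "closed_fm m n \<phi> \<Longrightarrow> (\<And>i. i < m \<Longrightarrow> e i = e' i) \<Longrightarrow> (\<And>i. i < n \<Longrightarrow> s i = s' i) \<Longrightarrow>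
    sat M e s \<phi> = sat M e' s' \<phi>"
proof (induction \<phi> arbitrary: m n e e' s s')
  case (Eq t u)
  then show ?case using val_cong[of m _ e e' M] by simp
next
  case (Rel p ts)
  then have "map (val M e) ts = map (val M e') ts"
    using val_cong[of m _ e e' M] by (auto simp: list_all_iff)
  then show ?case unfolding sat.simps by (rule arg_cong)
next
  case (InBr i t)
  then show ?case using val_cong[of m _ e e' M] by simp
next
  case (Ex \<phi>)
  have "sat M (case_nat a e) s \<phi> = sat M (case_nat a e') s' \<phi>" for a
    using Ex.prems by (intro Ex.IH[of "Suc m" n]) (auto split: nat.split)
  then show ?case by simp
next
  case (And \<phi> \<psi>)
  have "sat M e s \<phi> = sat M e' s' \<phi>"
    by (rule And.IH(1)[of m n]) (use And.prems in simp_all)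
  moreover have "sat M e s \<psi> = sat M e' s' \<psi>"
    by (rule And.IH(2)[of m n]) (use And.prems in simp_all)
  ultimately show ?case by simp
next
  case (Neg \<phi>)
  have "sat M e s \<phi> = sat M e' s' \<phi>"
    by (rule Neg.IH[of m n]) (use Neg.prems in simp_all)
  then show ?case by simp
next
  case (QBrch \<phi>1 \<phi>2 \<psi>1 \<psi>2 \<rho> \<Theta>)
  have 1: "sat M (case_nat a e) s \<phi>1 = sat M (case_nat a e') s' \<phi>1" for a
    using QBrch.prems by (intro QBrch.IH(1)[of "Suc m" n]) (auto split: nat.split)
  have 2: "sat M (case_nat a e) s \<phi>2 = sat M (case_nat a e') s' \<phi>2" for a
    using QBrch.prems by (intro QBrch.IH(2)[of "Suc m" n]) (auto split: nat.split)
  have 3: "sat M (case_nat a (case_nat c e)) s \<psi>1 = sat M (case_nat a (case_nat c e')) s' \<psi>1" for a c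
    using QBrch.prems by (intro QBrch.IH(3)[of "Suc (Suc m)" n]) (auto split: nat.split)
  have 4: "sat M (case_nat a (case_nat c e)) s \<psi>2 = sat M (case_nat a (case_nat c e')) s' \<psi>2" for a c
    using QBrch.prems by (intro QBrch.IH(4)[of "Suc (Suc m)" n]) (auto split: nat.split)
  have 5: "sat M (case_nat a (case_nat c e)) s \<rho> = sat M (case_nat a (case_nat c e')) s' \<rho>" for a c
    using QBrch.prems by (intro QBrch.IH(5)[of "Suc (Suc m)" n]) (auto split: nat.split)
  have 6: "sat M e (case_nat b s) \<Theta> = sat M e' (case_nat b s') \<Theta>" for b
    using QBrch.prems by (intro QBrch.IH(6)[of m "Suc n"]) (auto split: nat.split)
  show ?case by (simp add: 1 2 3 4 5 6)
qed

text \<open>Packs the tree that the semantics attaches to a branch quantifier \<open>q\<close>,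
  together with a candidate branch \<open>B\<close>, so that a single formula indexes it. Other
  formulas get a dummy empty tree.\<close>

definition fm_tree ::
  "('f, 'p, 'a) struct \<Rightarrow> (nat \<Rightarrow> 'a) \<Rightarrow> (nat \<Rightarrow> 'a set) \<Rightarrow> 'a set \<Rightarrow> ('f, 'p) fm \<Rightarrow> 'a ltree" where
  "fm_tree M e s B q = (case q of
     QBrch \<phi>1 \<phi>2 \<psi>1 \<psi>2 \<rho> \<Theta> \<Rightarrow>
       \<lparr>tU = {a \<in> univ M. sat M (case_nat a e) s \<phi>1},
        tV = {a \<in> univ M. sat M (case_nat a e) s \<phi>2},
        tL = {(a, c) \<in> univ M \<times> univ M. sat M (case_nat a (case_nat c e)) s \<psi>1},
        tM = {(a, c) \<in> univ M \<times> univ M. sat M (case_nat a (case_nat c e)) s \<psi>2},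
        tR = {(a, c) \<in> univ M \<times> univ M. sat M (case_nat a (case_nat c e)) s \<rho>},
        tB = B\<rparr>
   | _ \<Rightarrow> \<lparr>tU = {}, tV = {}, tL = {}, tM = {}, tR = {}, tB = B\<rparr>)"

definition fm_body :: "('f, 'p) fm \<Rightarrow> ('f, 'p) fm" where
  "fm_body q = (case q of QBrch \<phi>1 \<phi>2 \<psi>1 \<psi>2 \<rho> \<Theta> \<Rightarrow> \<Theta> | _ \<Rightarrow> q)"

lemma ltree_in_fm_tree: "ltree_in (univ M) (fm_tree M e s B q)"
  by (cases q) (auto simp: ltree_in_def fm_tree_def)

lemma sat_QBrch:
  fixes \<phi>1 :: "('f, 'p) fm"
  assumes "q = QBrch \<phi>1 \<phi>2 \<psi>1 \<psi>2 \<rho> \<Theta>"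
  shows "sat M e s q \<longleftrightarrow> (is_level_tree (fm_tree M e s B q) \<longrightarrow>
    (\<exists>b. is_branch (fm_tree M e s B q) b \<and> sat M e (case_nat b s) \<Theta>))"
  by (simp add: assms fm_tree_def Let_def)

text \<open>Lets a set stand for an element of \<open>A\<close>, so that a definable set doubles as
  a Skolem function for its own nonemptiness.\<close>

definition pick :: "'a set \<Rightarrow> 'a set \<Rightarrow> 'a" where
  "pick A X = (if X \<inter> A \<noteq> {} then SOME a. a \<in> X \<inter> A else SOME a. a \<in> A)"

lemma pick_in: "A \<noteq> {} \<Longrightarrow> pick A X \<in> A"
  unfolding pick_def by (metis IntE some_in_eq)

lemma pick_mem: "a \<in> X \<Longrightarrow> a \<in> A \<Longrightarrow> pick A X \<in> X"
  unfolding pick_def by (metis IntE IntI empty_iff some_in_eq)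

lemma pick_singleton: "a \<in> A \<Longrightarrow> pick A {a} = a"
  using pick_mem[of a "{a}" A] by simp

subsection \<open>The family of definable functions\<close>

inductive_set clo :: "('c list \<Rightarrow> 'c) set \<Rightarrow> 'c set" for Ops where
  clo: "h \<in> Ops \<Longrightarrow> (\<forall>c\<in>set cs. c \<in> clo Ops) \<Longrightarrow> h cs \<in> clo Ops"

definition bounds :: "'a ltree \<Rightarrow> 'a set \<Rightarrow> 'a set" where
  "bounds t X = {z \<in> tV t. \<forall>v\<in>tV t \<inter> X. (v, z) \<in> (tM t)\<^sup>=}"

text \<open>
  A point \<open>(S, x)\<close> consists of the index \<open>S\<close> of a structure and an \<open>\<omega>\<^sub>1\<close>-sequence of sets; almost
  everywhere in the sense of the filter \<open>W\<close> below, each of them is a finite subset of the universe.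
\<close>

type_synonym ('s, 'a) point = "'s \<times> (nat suc \<Rightarrow> 'a set)"

text \<open>\<open>E\<close> lives on the indices of the structures, each member of \<open>C\<close>
  names one value per structure, and \<open>T\<close> determines the formulas and function symbols
  under which the family is closed.\<close>

locale iterated_power =
  fixes M :: "'s \<Rightarrow> ('f, 'p, 'a) struct" and E :: "'s filter"
    and C :: "('s \<Rightarrow> 'a) set" and T :: "('f, 'p) fm set"
  assumes ultra_E: "ultra E" and struct_M: "\<And>S. is_struct (M S)"
begin

definition D :: "'s \<Rightarrow> 'a set filter" where
  "D S = ultra_below (finite_subsets_at_top (univ (M S)))"

abbreviation W :: "('s, 'a) point filter" where
  "W \<equiv> iter_filter E D"

lemma ultra_D: "ultra (D S)"
  unfolding D_def by (rule ultra_below) simp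

lemma eventually_D: "eventually P (finite_subsets_at_top (univ (M S))) \<Longrightarrow> eventually P (D S)"
  unfolding D_def by (rule filter_leD[OF ultra_below(1)]) simp_all

lemma ultra_W: "ultra W"
  by (rule ultra_iter_filter[OF ultra_E ultra_D])

lemma univ_ne: "univ (M S) \<noteq> {}"
  using struct_M by (simp add: is_struct_def)

definition el :: "(('s, 'a) point \<Rightarrow> 'a set) \<Rightarrow> ('s, 'a) point \<Rightarrow> 'a" where
  "el c \<omega> = pick (univ (M (fst \<omega>))) (c \<omega>)"

lemma el_in: "el c \<omega> \<in> univ (M (fst \<omega>))"
  unfolding el_def by (rule pick_in[OF univ_ne])

definition \<Phi> :: "('f, 'p) fm set" where "\<Phi> = (\<Union>\<phi>\<in>T. subf \<phi>)"

definition Fs :: "'f set" where "Fs = (\<Union>\<phi>\<in>T. funs_fm \<phi>)"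

text \<open>
  The pointwise operations: constants, function symbols, definable sets, branches witnessing a
  quantifier, upper bounds of the levels in a finite set, and the sets defined by the formulas
  that express in first-order terms that something is a level-tree or a branch.
\<close>

definition hC :: "('s \<Rightarrow> 'a) \<Rightarrow> 's \<Rightarrow> 'a set list \<Rightarrow> 'a list \<Rightarrow> 'a set list \<Rightarrow> 'a set" where
  "hC c S xs es bs = {c S}"

definition hU :: "'s \<Rightarrow> 'a set list \<Rightarrow> 'a list \<Rightarrow> 'a set list \<Rightarrow> 'a set" where
  "hU S xs es bs = univ (M S)"

definition hF :: "'f \<Rightarrow> 's \<Rightarrow> 'a set list \<Rightarrow> 'a list \<Rightarrow> 'a set list \<Rightarrow> 'a set" where
  "hF f S xs es bs = {fun_int (M S) f es}"

definition hE :: "('f, 'p) fm \<Rightarrow> 's \<Rightarrow> 'a set list \<Rightarrow> 'a list \<Rightarrow> 'a set list \<Rightarrow> 'a set" where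
  "hE \<phi> S xs es bs = {a \<in> univ (M S). sat (M S) (case_nat a ((!) es)) ((!) bs) \<phi>}"

definition hQ :: "('f, 'p) fm \<Rightarrow> 's \<Rightarrow> 'a set list \<Rightarrow> 'a list \<Rightarrow> 'a set list \<Rightarrow> 'a set" where
  "hQ q S xs es bs = (SOME b. is_branch (fm_tree (M S) ((!) es) ((!) bs) {} q) b \<and>
     sat (M S) ((!) es) (case_nat b ((!) bs)) (fm_body q))"

definition hV :: "('f, 'p) fm \<Rightarrow> 's \<Rightarrow> 'a set list \<Rightarrow> 'a list \<Rightarrow> 'a set list \<Rightarrow> 'a set" where
  "hV q S xs es bs = bounds (fm_tree (M S) ((!) es) ((!) bs) {} q) (hd xs)"

text \<open>Layout of the arguments: the first \<open>l\<close> elements are values for the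
  variables of \<open>\<beta>\<close>, the others parameters of the tree; the first set is the
  distinguished one, the others interpret branch variables.\<close>

definition hB :: "('f, 'p) fm \<Rightarrow> bf \<Rightarrow> nat \<Rightarrow> 's \<Rightarrow> 'a set list \<Rightarrow> 'a list \<Rightarrow> 'a set list \<Rightarrow> 'a set" where
  "hB q \<beta> l S xs es bs = {a \<in> univ (M S).
     ev (univ (M S)) (fm_tree (M S) ((!) (drop l es)) ((!) (tl bs)) (hd bs) q) (a # take l es) \<beta>}"

definition Hs :: "('s \<Rightarrow> 'a set list \<Rightarrow> 'a list \<Rightarrow> 'a set list \<Rightarrow> 'a set) set" where
  "Hs = {hU} \<union> hC ` C \<union> hF ` Fs \<union> hE ` \<Phi> \<union> hQ ` \<Phi> \<union> hV ` \<Phi> \<union> (\<lambda>(q, \<beta>, l). hB q \<beta> l) ` (\<Phi> \<times> UNIV \<times> UNIV)"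

text \<open>
  The members of the family are set-valued. They stand for branches, and through \<open>el\<close> also for elements,
  which makes closure under definable sets provide Skolem functions. The test \<open>cs \<noteq> []\<close> in \<open>qu\<close> is
  needed because \<open>hd []\<close> might depend on infinitely many coordinates.
\<close>

definition pw ::
  "('s \<Rightarrow> 'a set list \<Rightarrow> 'a list \<Rightarrow> 'a set list \<Rightarrow> 'a set) \<Rightarrow> nat suc list \<Rightarrow> nat \<Rightarrow>
   (('s, 'a) point \<Rightarrow> 'a set) list \<Rightarrow> ('s, 'a) point \<Rightarrow> 'a set" where
  "pw h is l cs \<omega> = h (fst \<omega>) (map (snd \<omega>) is) (map (\<lambda>c. el c \<omega>) (take l cs)) (map (\<lambda>c. c \<omega>) (drop l cs))"

definition qu :: "nat suc list \<Rightarrow> (('s, 'a) point \<Rightarrow> 'a set) list \<Rightarrow> ('s, 'a) point \<Rightarrow> 'a set" where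
  "qu r cs \<omega> = {a \<in> univ (M (fst \<omega>)). cs \<noteq> [] \<and> iterev (D (fst \<omega>)) r (\<lambda>x. a \<in> hd cs (fst \<omega>, x)) (snd \<omega>)}"

definition Ops :: "((('s, 'a) point \<Rightarrow> 'a set) list \<Rightarrow> ('s, 'a) point \<Rightarrow> 'a set) set" where
  "Ops = (\<lambda>(h, is, l). pw h is l) ` (Hs \<times> UNIV \<times> UNIV) \<union> range qu"

definition CC :: "(('s, 'a) point \<Rightarrow> 'a set) set" where
  "CC = clo Ops"

section \<open>Closure of the family and finite supports\<close>

lemma CC_pw:
  assumes "h \<in> Hs" "set es \<subseteq> CC" "set bs \<subseteq> CC"
  shows "(\<lambda>\<omega>. h (fst \<omega>) (map (snd \<omega>) is) (map (\<lambda>c. el c \<omega>) es) (map (\<lambda>c. c \<omega>) bs)) \<in> CC"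
proof -
  have "pw h is (length es) \<in> Ops"
    unfolding Ops_def by (rule UnI1, rule image_eqI[of _ _ "(h, is, length es)"]) (use assms in auto)
  then have "pw h is (length es) (es @ bs) \<in> clo Ops"
    using assms(2,3) by (intro clo.clo) (auto simp: CC_def)
  then show ?thesis by (simp add: pw_def[abs_def] CC_def)
qed

lemma CC_qu:
  assumes "c \<in> CC"
  shows "(\<lambda>\<omega>. {a \<in> univ (M (fst \<omega>)). iterev (D (fst \<omega>)) r (\<lambda>x. a \<in> c (fst \<omega>, x)) (snd \<omega>)}) \<in> CC"
proof -
  have "qu r [c] \<in> clo Ops"
    by (rule clo.clo) (use assms in \<open>simp_all add: Ops_def CC_def\<close>)
  then show ?thesis by (simp add: qu_def[abs_def] CC_def)
qed

lemma dependsD: "depends A f \<Longrightarrow> \<forall>i\<in>A. x i = x' i \<Longrightarrow> f (S, x) = f (S, x')"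
  by (simp add: depends_def)

lemma depends_el: "depends A c \<Longrightarrow> depends A (el c)"
  unfolding depends_def el_def by (metis fst_conv)

text \<open>A pointwise operation reads only its finite index list and the supports of its finitely
  many arguments; a generic quantifier adds at most the coordinates it binds.\<close>

lemma CC_depends:
  assumes "c \<in> CC"
  shows "\<exists>A. finite A \<and> depends A c"
  using assms unfolding CC_def
proof induction
  case (clo h cs)
  then have "\<forall>c\<in>set cs. \<exists>A. finite A \<and> depends A c" by blast
  from bchoice[OF this] obtain A where A0: "\<forall>c\<in>set cs. finite (A c) \<and> depends (A c) c" ..
  note A = bspec[OF A0]
  let ?A = "\<Union>c\<in>set cs. A c"
  have fin: "finite ?A" using A by auto
  have dep: "depends ?A c" if "c \<in> set cs" for c
    using A[OF that] that by (auto intro: depends_mono)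
  from clo.hyps consider (pw) g "is" l where "h = pw g is l" | (qu) r where "h = qu r"
    by (auto simp: Ops_def)
  then show ?case
  proof cases
    case pw
    have "depends (set is \<union> ?A) (h cs)"
      unfolding depends_def
    proof (intro allI impI)
      fix S and x x' :: "nat suc \<Rightarrow> 'a set" assume eq: "\<forall>i\<in>set is \<union> ?A. x i = x' i"
      have c: "c (S, x) = c (S, x')" "el c (S, x) = el c (S, x')" if "c \<in> set cs" for c
        by (rule dependsD[OF dep[OF that]], use eq in simp)
          (rule dependsD[OF depends_el[OF dep[OF that]]], use eq in simp)
      have "map x is = map x' is" using eq by simp
      moreover have "map (\<lambda>c. el c (S, x)) (take l cs) = map (\<lambda>c. el c (S, x')) (take l cs)"
        using c(2) by (auto dest: in_set_takeD)
      moreover have "map (\<lambda>c. c (S, x)) (drop l cs) = map (\<lambda>c. c (S, x')) (drop l cs)"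
        using c(1) by (auto dest: in_set_dropD)
      ultimately show "h cs (S, x) = h cs (S, x')" unfolding pw pw_def fst_conv snd_conv by (simp only:)
    qed
    then show ?thesis using fin by blast
  next
    case qu
    show ?thesis
    proof (cases cs)
      case Nil
      have "depends (set r) (h cs)"
        by (simp add: depends_def qu qu_def Nil)
      then show ?thesis by blast
    next
      case (Cons c cs')
      have it: "iterev (D S) r (\<lambda>u. a \<in> c (S, u)) x = iterev (D S) r (\<lambda>u. a \<in> c (S, u)) x'"
        if "\<forall>i\<in>set r \<union> ?A. x i = x' i" for S x x' a
      proof (rule iterev_cong[where A = "set r \<union> ?A"])
        show "(a \<in> c (S, u)) = (a \<in> c (S, u'))" if "\<forall>i\<in>set r \<union> ?A. u i = u' i" for u u'
          using dependsD[OF dep[of c], of u u' S] that Cons by simp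
      qed (use that in auto)
      have "depends (set r \<union> ?A) (h cs)"
        unfolding depends_def
      proof (intro allI impI)
        fix S and x x' :: "nat suc \<Rightarrow> 'a set" assume "\<forall>i\<in>set r \<union> ?A. x i = x' i"
        note it[OF this]
        then show "h cs (S, x) = h cs (S, x')" by (simp add: qu qu_def Cons)
      qed
      then show ?thesis using fin by blast
    qed
  qed
qed

end


subsection \<open>Branches are definable\<close>

definition lev :: "'a ltree \<Rightarrow> 'a \<Rightarrow> 'a" where
  "lev t a = (THE v. (a, v) \<in> tR t)"

lemma lev_eq:
  assumes "is_level_tree t" "(a, v) \<in> tR t"
  shows "lev t a = v"
proof -
  have "a \<in> tU t" using assms by (auto simp: level_tree_def)
  then have "\<exists>!v. (a, v) \<in> tR t" using assms(1) by (simp add: level_tree_def)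
  from this assms(2) show ?thesis unfolding lev_def by (rule the1_equality)
qed

lemma lev_rel:
  assumes "is_level_tree t" "a \<in> tU t"
  shows "(a, lev t a) \<in> tR t"
proof -
  have "\<exists>!v. (a, v) \<in> tR t" using assms by (simp add: level_tree_def)
  then show ?thesis unfolding lev_def by (rule theI')
qed

lemma lev_in: "is_level_tree t \<Longrightarrow> a \<in> tU t \<Longrightarrow> lev t a \<in> tV t"
  using lev_rel[of t a] by (auto simp: level_tree_def)

lemma level_tree_tL: "is_level_tree t \<Longrightarrow> (a, c) \<in> tL t \<Longrightarrow> a \<in> tU t \<and> c \<in> tU t"
  by (auto simp: level_tree_def)

lemma lev_mono:
  assumes t: "is_level_tree t" and ac: "(a, c) \<in> tL t"
  shows "(lev t a, lev t c) \<in> tM t"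
proof -
  have "\<forall>t' u v w. (t', u) \<in> tL t \<and> (t', v) \<in> tR t \<and> (u, w) \<in> tR t \<longrightarrow> (v, w) \<in> tM t"
    using t by (simp add: level_tree_def)
  then show ?thesis using ac lev_rel[OF t] level_tree_tL[OF t ac] by blast
qed

lemma level_tree_trans:
  assumes "is_level_tree t"
  shows "(a, b) \<in> tL t \<Longrightarrow> (b, c) \<in> tL t \<Longrightarrow> (a, c) \<in> tL t"
    and "(a, b) \<in> (tM t)\<^sup>= \<Longrightarrow> (b, c) \<in> (tM t)\<^sup>= \<Longrightarrow> (a, c) \<in> (tM t)\<^sup>="
  using assms by (auto simp: level_tree_def dest: transD)

lemma level_tree_below:
  assumes t: "level_tree U V L N R" and ac: "(a, c) \<in> L" and bc: "(b, c) \<in> L"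
  shows "a = b \<or> (a, b) \<in> L \<or> (b, a) \<in> L"
proof -
  have "total_on {y \<in> U. (y, c) \<in> L} L" "a \<in> U" "b \<in> U"
    using t ac bc by (auto simp: level_tree_def)
  then show ?thesis using ac bc by (auto simp: total_on_def)
qed

text \<open>Predecessors of a node are linearly ordered, so \<open>x\<close> is comparable with
  every member of the branch, and maximality puts it in.\<close>

lemma branch_downward:
  assumes t: "level_tree U V L N R" and b: "branch U V L N R b" and xy: "(x, y) \<in> L" and y: "y \<in> b"
  shows "x \<in> b"
proof -
  have bU: "b \<subseteq> U" "total_on b L" and max: "\<And>c. b \<subseteq> c \<Longrightarrow> c \<subseteq> U \<Longrightarrow> total_on c L \<Longrightarrow> c = b"
    using b by (auto simp: branch_def)
  have tr: "trans L" and xU: "x \<in> U" using t xy by (auto simp: level_tree_def)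
  have "x = z \<or> (x, z) \<in> L \<or> (z, x) \<in> L" if "z \<in> b" for z
  proof -
    have "y = z \<or> (y, z) \<in> L \<or> (z, y) \<in> L" using bU(2) y that unfolding total_on_def by blast
    then show ?thesis using xy transD[OF tr xy] level_tree_below[OF t xy] by blast
  qed
  then have "total_on (insert x b) L" using bU(2) unfolding total_on_def by blast
  then have "insert x b = b" using max[of "insert x b"] bU(1) xU by blast
  then show ?thesis by blast
qed

text \<open>Directedness, applied once for each new element of \<open>X\<close> that is a
  level.\<close>

lemma bounds_ne:
  assumes t: "is_level_tree t" and "finite X"
  shows "bounds t X \<noteq> {}"
  using \<open>finite X\<close>
proof (induction X)
  case empty
  have "tV t \<noteq> {}" using t unfolding level_tree_def by blast
  then show ?case by (simp add: bounds_def)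
next
  case (insert x X)
  then obtain z where z: "z \<in> tV t" "\<And>v. v \<in> tV t \<Longrightarrow> v \<in> X \<Longrightarrow> (v, z) \<in> (tM t)\<^sup>="
    by (auto simp: bounds_def)
  show ?case
  proof (cases "x \<in> tV t")
    case True
    have "\<forall>v\<in>tV t. \<forall>w\<in>tV t. \<exists>z\<in>tV t. (v, z) \<in> (tM t)\<^sup>= \<and> (w, z) \<in> (tM t)\<^sup>="
      using t by (simp add: level_tree_def)
    then obtain z' where z': "z' \<in> tV t" "(x, z') \<in> (tM t)\<^sup>=" "(z, z') \<in> (tM t)\<^sup>="
      using True z(1) by blast
    have "(v, z') \<in> (tM t)\<^sup>=" if "v \<in> tV t" "v \<in> X" for v
      using level_tree_trans(2)[OF t z(2)[OF that] z'(3)] .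
    then have "z' \<in> bounds t (insert x X)" using z' unfolding bounds_def by blast
    then show ?thesis by blast
  next
    case False
    then have "z \<in> bounds t (insert x X)" using z unfolding bounds_def by blast
    then show ?thesis by blast
  qed
qed

text \<open>\<open>\<rho>\<close> codes the classes modulo almost everywhere equality. The type of
  codes is arbitrary, so the universe can be placed inside a set of prescribed size.\<close>

locale iterated_model = iterated_power M E C T
  for M :: "'s \<Rightarrow> ('f, 'p, 'a) struct" and E C T +
  fixes \<rho> :: "(('s, 'a) point \<Rightarrow> 'a set) \<Rightarrow> 'k"
  assumes \<rho>: "c \<in> CC \<Longrightarrow> d \<in> CC \<Longrightarrow> \<rho> c = \<rho> d \<longleftrightarrow> eventually (\<lambda>\<omega>. el c \<omega> = el d \<omega>) W"
begin

text \<open>The internal subset of the ultrapower represented by \<open>B\<close>.\<close>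

definition rset :: "(('s, 'a) point \<Rightarrow> 'a set) \<Rightarrow> 'k set" where
  "rset B = {\<rho> c | c. c \<in> CC \<and> eventually (\<lambda>\<omega>. el c \<omega> \<in> B \<omega>) W}"

lemma \<rho>_in_rset:
  assumes "c \<in> CC"
  shows "\<rho> c \<in> rset B \<longleftrightarrow> eventually (\<lambda>\<omega>. el c \<omega> \<in> B \<omega>) W"
proof
  assume "\<rho> c \<in> rset B"
  then obtain d where d: "d \<in> CC" "\<rho> c = \<rho> d" and B: "eventually (\<lambda>\<omega>. el d \<omega> \<in> B \<omega>) W"
    unfolding rset_def by blast
  from d have "eventually (\<lambda>\<omega>. el c \<omega> = el d \<omega>) W" using \<rho> assms by simp
  with B show "eventually (\<lambda>\<omega>. el c \<omega> \<in> B \<omega>) W" by eventually_elim simp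
qed (use assms in \<open>auto simp: rset_def\<close>)

lemma finite_coord: "eventually (\<lambda>\<omega>. finite (snd \<omega> i)) W"
proof (rule eventually_iter_filter_last[OF ultra_E ultra_D, where A = "{}" and i = i])
  show "depends {i} (\<lambda>\<omega>. finite (snd \<omega> i))" by (simp add: depends_def)
  show "eventually (\<lambda>y. finite (snd (S, x(i := y)) i)) (D S)" for S and x :: "nat suc \<Rightarrow> 'a set"
    by (rule eventually_D) (auto simp: eventually_finite_subsets_at_top)
qed auto

text \<open>Fineness of \<open>D\<close>: almost all finite sets contain a given element, and the
  value of \<open>f\<close> is settled before coordinate \<open>i\<close> is chosen.\<close>

lemma in_coord:
  assumes f: "depends A f" "\<And>\<omega>. f \<omega> \<in> univ (M (fst \<omega>))" and A: "finite A" "\<And>a. a \<in> A \<Longrightarrow> a < i"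
  shows "eventually (\<lambda>\<omega>. f \<omega> \<in> snd \<omega> i) W"
proof (rule eventually_iter_filter_last[OF ultra_E ultra_D A])
  show "depends (insert i A) (\<lambda>\<omega>. f \<omega> \<in> snd \<omega> i)"
    unfolding depends_def
  proof (intro allI impI)
    fix S and x x' :: "nat suc \<Rightarrow> 'a set" assume "\<forall>j\<in>insert i A. x j = x' j"
    then show "(f (S, x) \<in> snd (S, x) i) = (f (S, x') \<in> snd (S, x') i)"
      using dependsD[OF f(1), of x x' S] by simp
  qed
  show "eventually (\<lambda>y. f (S, x(i := y)) \<in> snd (S, x(i := y)) i) (D S)" for S and x :: "nat suc \<Rightarrow> 'a set"
  proof (rule eventually_D)
    have "f (S, x(i := y)) = f (S, x)" for y
      by (rule dependsD[OF f(1)]) (use A(2) in auto)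
    moreover have "f (S, x) \<in> univ (M S)" using f(2)[of "(S, x)"] by simp
    ultimately show "eventually (\<lambda>y. f (S, x(i := y)) \<in> snd (S, x(i := y)) i) (finite_subsets_at_top (univ (M S)))"
      by (auto simp: eventually_finite_subsets_at_top intro!: exI[of _ "{f (S, x)}"])
  qed
qed

section \<open>An arbitrary branch \<open>b\<close> of the ultrapower of level-trees
  \<open>t\<close>\<close>

context
  fixes t :: "('s, 'a) point \<Rightarrow> 'a ltree" and A0 U V L N R and b :: "'k set"
  assumes A0: "finite A0" "depends A0 t"
    and tree: "eventually (\<lambda>\<omega>. is_level_tree (t \<omega>)) W"
    and tin: "\<And>\<omega>. ltree_in (univ (M (fst \<omega>))) (t \<omega>)"
    and low: "\<And>g. g \<in> CC \<Longrightarrow> (\<lambda>\<omega>. {a \<in> univ (M (fst \<omega>)). (a, el g \<omega>) \<in> tL (t \<omega>)}) \<in> CC"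
    and bnd: "\<And>i. (\<lambda>\<omega>. bounds (t \<omega>) (snd \<omega> i)) \<in> CC"
    and U: "\<And>c. c \<in> CC \<Longrightarrow> \<rho> c \<in> U \<longleftrightarrow> eventually (\<lambda>\<omega>. el c \<omega> \<in> tU (t \<omega>)) W"
    and V: "\<And>c. c \<in> CC \<Longrightarrow> \<rho> c \<in> V \<longleftrightarrow> eventually (\<lambda>\<omega>. el c \<omega> \<in> tV (t \<omega>)) W"
    and L: "\<And>c d. c \<in> CC \<Longrightarrow> d \<in> CC \<Longrightarrow> (\<rho> c, \<rho> d) \<in> L \<longleftrightarrow> eventually (\<lambda>\<omega>. (el c \<omega>, el d \<omega>) \<in> tL (t \<omega>)) W"
    and N: "\<And>c d. c \<in> CC \<Longrightarrow> d \<in> CC \<Longrightarrow> (\<rho> c, \<rho> d) \<in> N \<longleftrightarrow> eventually (\<lambda>\<omega>. (el c \<omega>, el d \<omega>) \<in> tM (t \<omega>)) W"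
    and R: "\<And>c d. c \<in> CC \<Longrightarrow> d \<in> CC \<Longrightarrow> (\<rho> c, \<rho> d) \<in> R \<longleftrightarrow> eventually (\<lambda>\<omega>. (el c \<omega>, el d \<omega>) \<in> tR (t \<omega>)) W"
    and UV: "U \<subseteq> \<rho> ` CC" "V \<subseteq> \<rho> ` CC"
    and lt: "level_tree U V L N R" and br: "branch U V L N R b"
begin

definition level_ub :: "nat suc \<Rightarrow> ('s, 'a) point \<Rightarrow> 'a" where
  "level_ub i = el (\<lambda>\<omega>. bounds (t \<omega>) (snd \<omega> i))"

lemma level_ub_in: "eventually (\<lambda>\<omega>. level_ub i \<omega> \<in> bounds (t \<omega>) (snd \<omega> i)) W"
  using tree finite_coord[of i]
proof eventually_elim
  case (elim \<omega>)
  then obtain z where "z \<in> bounds (t \<omega>) (snd \<omega> i)" using bounds_ne by blast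
  moreover from this have "z \<in> univ (M (fst \<omega>))" using tin[of \<omega>] by (auto simp: bounds_def ltree_in_def)
  ultimately show ?case unfolding level_ub_def el_def by (rule pick_mem)
qed

text \<open>The value of \<open>f\<close> almost surely belongs to the generic set at coordinate
  \<open>i\<close>, whose levels are bounded by \<open>level_ub i\<close>.\<close>

lemma level_ub_bound:
  assumes f: "depends A f" "\<And>\<omega>. f \<omega> \<in> univ (M (fst \<omega>))" and A: "finite A" "\<And>a. a \<in> A \<Longrightarrow> a < i"
  shows "eventually (\<lambda>\<omega>. f \<omega> \<in> tV (t \<omega>) \<longrightarrow> (f \<omega>, level_ub i \<omega>) \<in> (tM (t \<omega>))\<^sup>=) W"
proof -
  have "eventually (\<lambda>\<omega>. f \<omega> \<in> snd \<omega> i) W"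
    by (rule in_coord[OF f(1)]) (use f A in auto)
  then show ?thesis using level_ub_in[of i] by eventually_elim (simp add: bounds_def)
qed

lemma level_ub_cong: "t \<omega> = t \<omega>' \<Longrightarrow> fst \<omega> = fst \<omega>' \<Longrightarrow> snd \<omega> i = snd \<omega>' i' \<Longrightarrow> level_ub i \<omega> = level_ub i' \<omega>'"
  by (simp add: level_ub_def el_def)

text \<open>The level of \<open>f\<close> depends on coordinates before \<open>i\<close> only, hence
  is at most \<open>level_ub i\<close>. If \<open>g\<close> were equal to \<open>f\<close> or below
  it, the same would hold for the level of \<open>g\<close>; comparability leaves only
  \<open>f\<close> below \<open>g\<close>.\<close>

lemma above:
  assumes f: "depends A f" "\<And>\<omega>. f \<omega> \<in> univ (M (fst \<omega>))"
    and A: "finite A" "\<And>a. a \<in> A \<Longrightarrow> a < i" "A0 \<subseteq> A"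
    and fU: "eventually (\<lambda>\<omega>. f \<omega> \<in> tU (t \<omega>)) W"
    and cmp: "eventually (\<lambda>\<omega>. f \<omega> = g \<omega> \<or> (f \<omega>, g \<omega>) \<in> tL (t \<omega>) \<or> (g \<omega>, f \<omega>) \<in> tL (t \<omega>)) W"
    and g: "eventually (\<lambda>\<omega>. (lev (t \<omega>) (g \<omega>), level_ub i \<omega>) \<notin> (tM (t \<omega>))\<^sup>=) W"
  shows "eventually (\<lambda>\<omega>. (f \<omega>, g \<omega>) \<in> tL (t \<omega>)) W"
proof -
  \<comment> \<open>Where \<open>f \<omega>\<close> is a node of a level-tree this is its level;
    \<open>pick\<close> ensures a value in the universe at the remaining points.\<close>
  define h where "h \<omega> = pick (univ (M (fst \<omega>))) {lev (t \<omega>) (f \<omega>)}" for \<omega>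
  have "depends A t" using A0(2) A(3) by (rule depends_mono)
  have "depends A h"
    unfolding depends_def
  proof (intro allI impI)
    fix S and x x' :: "nat suc \<Rightarrow> 'a set" assume "\<forall>i\<in>A. x i = x' i"
    then show "h (S, x) = h (S, x')"
      using dependsD[OF f(1), of x x' S] dependsD[OF \<open>depends A t\<close>, of x x' S] by (simp add: h_def)
  qed
  then have "eventually (\<lambda>\<omega>. h \<omega> \<in> tV (t \<omega>) \<longrightarrow> (h \<omega>, level_ub i \<omega>) \<in> (tM (t \<omega>))\<^sup>=) W"
    by (rule level_ub_bound) (simp_all add: h_def pick_in univ_ne A)
  with tree fU cmp g show ?thesis
  proof eventually_elim
    case (elim \<omega>)
    have lV: "lev (t \<omega>) (f \<omega>) \<in> tV (t \<omega>)" using elim by (simp add: lev_in)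
    then have "lev (t \<omega>) (f \<omega>) \<in> univ (M (fst \<omega>))" using tin[of \<omega>] by (auto simp: ltree_in_def)
    then have "h \<omega> = lev (t \<omega>) (f \<omega>)" unfolding h_def by (rule pick_singleton)
    then have le: "(lev (t \<omega>) (f \<omega>), level_ub i \<omega>) \<in> (tM (t \<omega>))\<^sup>=" using elim(5) lV by simp
    have "(lev (t \<omega>) (g \<omega>), level_ub i \<omega>) \<in> (tM (t \<omega>))\<^sup>=" if "(g \<omega>, f \<omega>) \<in> tL (t \<omega>)"
      by (rule level_tree_trans(2)[OF elim(1) _ le]) (simp add: lev_mono[OF elim(1) that])
    then show ?case using elim(3,4) le by auto
  qed
qed

lemma branch_D: "b \<subseteq> U" "total_on b L" "\<not> (\<exists>z\<in>V. \<forall>w\<in>R `` b. (w, z) \<in> N\<^sup>=)"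
  using br by (simp_all add: branch_def)

lemma branch_comparable:
  assumes "c \<in> CC" "d \<in> CC" "\<rho> c \<in> b" "\<rho> d \<in> b"
  shows "eventually (\<lambda>\<omega>. el c \<omega> = el d \<omega> \<or> (el c \<omega>, el d \<omega>) \<in> tL (t \<omega>) \<or> (el d \<omega>, el c \<omega>) \<in> tL (t \<omega>)) W"
proof -
  have "\<rho> c = \<rho> d \<or> (\<rho> c, \<rho> d) \<in> L \<or> (\<rho> d, \<rho> c) \<in> L"
    using branch_D(2) assms(3,4) unfolding total_on_def by metis
  then show ?thesis using assms by (simp add: \<rho> L ultra_or[OF ultra_W])
qed

lemma branch_tU: "c \<in> CC \<Longrightarrow> \<rho> c \<in> b \<Longrightarrow> eventually (\<lambda>\<omega>. el c \<omega> \<in> tU (t \<omega>)) W"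
  using U[of c] branch_D(1) by blast

text \<open>\<open>level_ub i\<close> represents an element of \<open>V\<close>, which cannot bound
  the levels of the branch.\<close>

lemma branch_unbounded:
  "\<exists>c\<in>CC. \<rho> c \<in> b \<and> eventually (\<lambda>\<omega>. (lev (t \<omega>) (el c \<omega>), level_ub i \<omega>) \<notin> (tM (t \<omega>))\<^sup>=) W"
proof -
  let ?z = "\<lambda>\<omega>. bounds (t \<omega>) (snd \<omega> i)"
  have "eventually (\<lambda>\<omega>. el ?z \<omega> \<in> tV (t \<omega>)) W"
    using level_ub_in[of i] unfolding level_ub_def by eventually_elim (simp add: bounds_def)
  then have "\<rho> ?z \<in> V" using V[OF bnd] by simp
  then have "\<not> (\<forall>w \<in> R `` b. (w, \<rho> ?z) \<in> N\<^sup>=)" using branch_D(3) by blast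
  then obtain x w where w: "(x, w) \<in> R" "x \<in> b" "(w, \<rho> ?z) \<notin> N\<^sup>=" by blast
  have "R \<subseteq> U \<times> V" using lt by (simp add: level_tree_def)
  then have "x \<in> U" "w \<in> V" using w(1) by auto
  then obtain c d where c: "c \<in> CC" "x = \<rho> c" and d: "d \<in> CC" "w = \<rho> d" using UV by blast
  have "\<not> eventually (\<lambda>\<omega>. el d \<omega> = level_ub i \<omega> \<or> (el d \<omega>, level_ub i \<omega>) \<in> tM (t \<omega>)) W"
    using w(3) d bnd[of i] by (simp add: \<rho> N level_ub_def ultra_or[OF ultra_W])
  then have "eventually (\<lambda>\<omega>. \<not> (el d \<omega> = level_ub i \<omega> \<or> (el d \<omega>, level_ub i \<omega>) \<in> tM (t \<omega>))) W"
    by (rule iffD2[OF ultra_not[OF ultra_W]])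
  moreover have "eventually (\<lambda>\<omega>. (el c \<omega>, el d \<omega>) \<in> tR (t \<omega>)) W"
    using w(1) c d R by simp
  ultimately have "eventually (\<lambda>\<omega>. (lev (t \<omega>) (el c \<omega>), level_ub i \<omega>) \<notin> (tM (t \<omega>))\<^sup>=) W"
    using tree by eventually_elim (simp add: lev_eq)
  then show ?thesis using c w(2) by blast
qed

lemma ex_bound: "finite A \<Longrightarrow> \<exists>i :: nat suc. \<forall>a\<in>A. a < i"
  by (rule countable_bounded_suc) (rule countable_finite)

lemma branch_definable:
  "\<exists>B\<in>CC. (\<forall>\<omega>. B \<omega> \<subseteq> univ (M (fst \<omega>))) \<and> b = rset B"
proof -
  let ?below = "\<lambda>f g \<omega>. (f \<omega>, g \<omega>) \<in> tL (t \<omega>)"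
  let ?nb = "\<lambda>g i \<omega>. (lev (t \<omega>) (g \<omega>), level_ub i \<omega>) \<notin> (tM (t \<omega>))\<^sup>="
  define Q where "Q j c \<sigma> \<longleftrightarrow>
    c \<in> CC \<and> \<rho> c \<in> b \<and> eventually (?nb (el c) j) W \<and> finite \<sigma> \<and> depends \<sigma> (el c)" for j c \<sigma>
  have "\<forall>j. \<exists>c \<sigma>. Q j c \<sigma>"
    unfolding Q_def
  proof
    fix j
    obtain c where c: "c \<in> CC" "\<rho> c \<in> b" "eventually (?nb (el c) j) W"
      using branch_unbounded[of j] by blast
    moreover obtain \<sigma> where "finite \<sigma>" "depends \<sigma> (el c)"
      using CC_depends[OF c(1)] depends_el by blast
    ultimately show "\<exists>c \<sigma>. c \<in> CC \<and> \<rho> c \<in> b \<and> eventually (?nb (el c) j) W \<and> finite \<sigma> \<and> depends \<sigma> (el c)"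
      by blast
  qed
  then obtain tt \<sigma> where Q: "\<And>j. Q j (tt j) (\<sigma> j)" by metis
  then have tt: "\<And>j. tt j \<in> CC" "\<And>j. \<rho> (tt j) \<in> b" "\<And>j. eventually (?nb (el (tt j)) j) W"
    and \<sigma>: "\<And>j. finite (\<sigma> j)" "\<And>j. depends (\<sigma> j) (el (tt j))"
    by (simp_all add: Q_def)
  obtain s0 where s0: "finite s0" "\<And>i. \<exists>j\<ge>i. \<sigma> j \<inter> {..i} \<subseteq> s0"
    using finite_supports_root[of \<sigma>] \<sigma>(1) by blast
  \<comment> \<open>Adding the support of \<open>t\<close> makes the tree invariant under every
    renaming that fixes \<open>s\<close>.\<close>
  define s where "s = s0 \<union> A0"
  have s: "finite s" "A0 \<subseteq> s" "\<And>i. \<exists>j\<ge>i. \<sigma> j \<inter> {..i} \<subseteq> s"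
    using s0(1) A0(1) s0(2) unfolding s_def by (simp_all add: le_supI1) (meson le_supI1)
  \<comment> \<open>\<open>i1\<close> separates the fixed coordinates \<open>s\<close> from the
    movable coordinates \<open>r\<close> of the node \<open>g\<close>.\<close>
  obtain i1 where i1: "\<And>a. a \<in> s \<Longrightarrow> a < i1" using ex_bound[OF s(1)] by blast
  obtain j0 where j0: "i1 \<le> j0" "\<sigma> j0 \<inter> {..i1} \<subseteq> s" using s(3) by blast
  define g where "g = tt j0"
  define r where "r = \<sigma> j0 \<inter> {i1<..}"
  have g: "g \<in> CC" "\<rho> g \<in> b" using tt by (auto simp: g_def)
  have r: "finite r" "\<And>a. a \<in> r \<Longrightarrow> i1 < a" using \<sigma>(1) by (auto simp: r_def)
  have "\<sigma> j0 \<subseteq> s \<union> r" using j0(2) by (force simp: r_def)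
  then have dep_g: "depends (s \<union> r) (el g)" using \<sigma>(2)[of j0] unfolding g_def by (rule depends_mono[rotated])
  have t_cong: "t (S, x) = t (S, x')" if "\<forall>i\<in>s. x i = x' i" for S x x'
    by (rule dependsD[OF A0(2)]) (use that s(2) in auto)
  \<comment> \<open>\<open>level_ub i1\<close> is at most \<open>level_ub j0\<close> almost
    everywhere, so it does not bound the level of \<open>g\<close> either. Since \<open>i1\<close>
    lies before all of \<open>r\<close>, it can later be moved together with
    \<open>r\<close>.\<close>
  have nb1: "eventually (?nb (el g) i1) W"
  proof (cases "j0 = i1")
    case True
    then show ?thesis using tt(3)[of j0] by (simp add: g_def)
  next
    case False
    then have "i1 < j0" using j0(1) by simp
    have "depends (insert i1 s) (level_ub i1)"
      unfolding depends_def
    proof (intro allI impI)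
      fix S and x x' :: "nat suc \<Rightarrow> 'a set" assume "\<forall>i\<in>insert i1 s. x i = x' i"
      then show "level_ub i1 (S, x) = level_ub i1 (S, x')" using t_cong[of x x' S] by (intro level_ub_cong) auto
    qed
    then have "eventually (\<lambda>\<omega>. level_ub i1 \<omega> \<in> tV (t \<omega>) \<longrightarrow> (level_ub i1 \<omega>, level_ub j0 \<omega>) \<in> (tM (t \<omega>))\<^sup>=) W"
      by (rule level_ub_bound) (use \<open>i1 < j0\<close> i1 s(1) in \<open>auto simp: level_ub_def el_in dest: less_trans\<close>)
    then show ?thesis using tree level_ub_in[of i1] tt(3)[of j0]
    proof eventually_elim
      case (elim \<omega>)
      have "level_ub i1 \<omega> \<in> tV (t \<omega>)" using elim(3) by (simp add: bounds_def)
      then have "(level_ub i1 \<omega>, level_ub j0 \<omega>) \<in> (tM (t \<omega>))\<^sup>=" using elim(1) by simp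
      then show ?case using level_tree_trans(2)[OF elim(2)] elim(4) unfolding g_def by blast
    qed
  qed
  \<comment> \<open>These are the nodes below \<open>g\<close>; quantifying over generic values at
    \<open>r\<close> leaves a set \<open>B\<close> that depends only on \<open>s\<close>.\<close>
  define B0 where "B0 = (\<lambda>\<omega>. {a \<in> univ (M (fst \<omega>)). (a, el g \<omega>) \<in> tL (t \<omega>)})"
  define B where "B = (\<lambda>\<omega>. {a \<in> univ (M (fst \<omega>)).
    iterev (D (fst \<omega>)) (sorted_list_of_set r) (\<lambda>x. a \<in> B0 (fst \<omega>, x)) (snd \<omega>)})"
  have "B \<in> CC" unfolding B_def by (rule CC_qu) (simp add: B0_def low g)
  have dep_B0: "depends (s \<union> r) B0"
    unfolding depends_def
  proof (intro allI impI)
    fix S and x x' :: "nat suc \<Rightarrow> 'a set" assume "\<forall>i\<in>s \<union> r. x i = x' i"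
    then show "B0 (S, x) = B0 (S, x')"
      using t_cong[of x x' S] dependsD[OF dep_g, of x x' S] by (simp add: B0_def)
  qed
  have main: "eventually (\<lambda>\<omega>. el y \<omega> \<in> B \<omega>) W \<longleftrightarrow> \<rho> y \<in> b" if y: "y \<in> CC" for y
  proof -
    obtain Y0 where Y0: "finite Y0" "depends Y0 (el y)" using CC_depends[OF y] depends_el by blast
    define Y where "Y = Y0 \<union> s \<union> {i1}"
    have Y: "finite Y" "depends Y (el y)" "s \<subseteq> Y" "i1 \<in> Y"
      using Y0 s(1) by (auto simp: Y_def intro: depends_mono)
    obtain i2 where i2: "\<And>a. a \<in> Y \<Longrightarrow> a < i2" using ex_bound[OF Y(1)] by blast
    obtain \<pi> where \<pi>: "strict_mono_on (insert i1 r) \<pi>" "\<And>a. a \<in> insert i1 r \<Longrightarrow> i2 < \<pi> a"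
      using ex_strict_mono_above[of "insert i1 r" i2] r(1) by auto
    have Y\<pi>: "c < \<pi> a" if "c \<in> Y" "a \<in> insert i1 r" for a c
      using i2[OF that(1)] \<pi>(2)[OF that(2)] by (rule less_trans)
    define \<pi>2 where "\<pi>2 i = (if i \<in> r then \<pi> i else i)" for i
    \<comment> \<open>A copy of \<open>g\<close> whose movable coordinates lie beyond the support of
      \<open>y\<close>. By \<open>inB\<close>, membership of \<open>y\<close> in \<open>B\<close>
      means being below this copy.\<close>
    define g' where "g' \<omega> = el g (fst \<omega>, \<lambda>i. snd \<omega> (\<pi>2 i))" for \<omega>
    have s_r: "a \<notin> r" if "a \<in> s" for a using i1[OF that] r(2)[of a] by auto
    have t2: "t (fst \<omega>, \<lambda>i. snd \<omega> (\<pi>2 i)) = t \<omega>" for \<omega>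
      using t_cong[of "\<lambda>i. snd \<omega> (\<pi>2 i)" "snd \<omega>" "fst \<omega>"] s_r by (simp add: \<pi>2_def)
    have inB: "eventually (\<lambda>\<omega>. el y \<omega> \<in> B \<omega>) W \<longleftrightarrow> eventually (?below (el y) g') W"
    proof -
      have "eventually (\<lambda>\<omega>. iterev (D (fst \<omega>)) (sorted_list_of_set r) (\<lambda>x. el y \<omega> \<in> B0 (fst \<omega>, x)) (snd \<omega>)) W
        \<longleftrightarrow> eventually (\<lambda>\<omega>. el y \<omega> \<in> B0 (fst \<omega>, \<lambda>i. snd \<omega> (if i \<in> r then \<pi> i else i))) W"
        by (rule eventually_iter_filter_quant[OF ultra_E ultra_D Y(1) r(1) Y(2) dep_B0 Y(3)])
          (use \<pi>(1) Y\<pi> in \<open>auto simp: strict_mono_on_def\<close>)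
      moreover have "el y \<omega> \<in> B0 (fst \<omega>, \<lambda>i. snd \<omega> (if i \<in> r then \<pi> i else i)) \<longleftrightarrow> ?below (el y) g' \<omega>" for \<omega>
        using t2[of \<omega>] el_in[of y \<omega>] by (simp add: B0_def g'_def \<pi>2_def)
      moreover have "el y \<omega> \<in> B \<omega> \<longleftrightarrow> iterev (D (fst \<omega>)) (sorted_list_of_set r) (\<lambda>x. el y \<omega> \<in> B0 (fst \<omega>, x)) (snd \<omega>)" for \<omega>
        using el_in[of y \<omega>] by (simp add: B_def)
      ultimately show ?thesis by simp
    qed
    \<comment> \<open>A branch node \<open>h\<close> taken from a stage \<open>j\<close> not before
      \<open>i3\<close> lies, by \<open>above\<close>, over every branch node with support before
      \<open>i3\<close>, in particular over \<open>g\<close>.\<close>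
    obtain i3 where i3: "\<And>a. a \<in> Y \<union> r \<union> \<pi> ` r \<Longrightarrow> a < i3"
      using ex_bound[of "Y \<union> r \<union> \<pi> ` r"] Y(1) r(1) by auto
    obtain j where j: "i3 \<le> j" "\<sigma> j \<inter> {..i3} \<subseteq> s" using s(3) by blast
    define h where "h = tt j"
    have h: "h \<in> CC" "\<rho> h \<in> b" "depends (\<sigma> j) (el h)" "eventually (?nb (el h) j) W"
      using tt \<sigma>(2) by (auto simp: h_def)
    \<comment> \<open>\<open>h\<close> has no coordinates outside \<open>s\<close> up to \<open>i3\<close>, so \<open>\<pi>2\<close> moves \<open>g\<close> to \<open>g'\<close> and fixes \<open>h\<close>.\<close>
    have g_h: "eventually (?below (el g) (el h)) W"
    proof (rule above[OF dep_g])
      show "a < j" if "a \<in> s \<union> r" for a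
        using i3[of a] that Y(3) j(1) by (auto intro: less_le_trans)
    qed (use s(1,2) r(1) h g in \<open>auto simp: el_in intro: branch_tU branch_comparable\<close>)
    have \<sigma>_j: "a \<in> s \<or> i3 < a" if "a \<in> \<sigma> j" for a
      using j(2) that by (force simp: not_less)
    have dep_below: "depends (s \<union> r \<union> \<sigma> j) (?below (el g) (el h))"
      unfolding depends_def
    proof (intro allI impI)
      fix S and x x' :: "nat suc \<Rightarrow> 'a set" assume "\<forall>i\<in>s \<union> r \<union> \<sigma> j. x i = x' i"
      then show "?below (el g) (el h) (S, x) = ?below (el g) (el h) (S, x')"
        using t_cong[of x x' S] dependsD[OF dep_g, of x x' S] dependsD[OF h(3), of x x' S] by simp
    qed
    have "strict_mono_on (s \<union> r \<union> \<sigma> j) \<pi>2"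
      unfolding strict_mono_on_def
    proof (intro allI impI, elim conjE)
      fix a c assume ac: "a \<in> s \<union> r \<union> \<sigma> j" "c \<in> s \<union> r \<union> \<sigma> j" "a < c"
      consider "a \<in> r" "c \<in> r" | "a \<in> r" "c \<notin> r" | "a \<notin> r" "c \<in> r" | "a \<notin> r" "c \<notin> r" by blast
      then show "\<pi>2 a < \<pi>2 c"
      proof cases
        case 1
        then show ?thesis using \<pi>(1) ac(3) by (simp add: \<pi>2_def strict_mono_on_def)
      next
        case 2
        have "c \<notin> s" using i1[of c] r(2)[OF 2(1)] ac(3) by auto
        then have "i3 < c" using \<sigma>_j[of c] ac(2) 2(2) by blast
        then show ?thesis using i3[of "\<pi> a"] 2 by (simp add: \<pi>2_def)
      next
        case 3
        have "\<not> i3 < a" using ac(3) i3[of c] 3(2) by auto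
        then have "a \<in> Y" using \<sigma>_j[of a] ac(1) 3(1) Y(3) by blast
        then show ?thesis using Y\<pi>[of a c] 3 by (simp add: \<pi>2_def)
      next
        case 4
        then show ?thesis using ac(3) by (simp add: \<pi>2_def)
      qed
    qed
    from eventually_iter_filter_rename[OF ultra_E ultra_D _ this dep_below] g_h
    have "eventually (\<lambda>\<omega>. ?below (el g) (el h) (fst \<omega>, \<lambda>i. snd \<omega> (\<pi>2 i))) W"
      using s(1) r(1) \<sigma>(1) by simp
    moreover have "el h (fst \<omega>, \<lambda>i. snd \<omega> (\<pi>2 i)) = el h \<omega>" for \<omega>
    proof -
      have "a \<notin> r" if "a \<in> \<sigma> j" for a
        using \<sigma>_j[OF that] s_r[of a] i3[of a] by auto
      then show ?thesis
        using dependsD[OF h(3), of "\<lambda>i. snd \<omega> (\<pi>2 i)" "snd \<omega>" "fst \<omega>"] by (simp add: \<pi>2_def)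
    qed
    ultimately have g'_h: "eventually (?below g' (el h)) W"
      by (simp add: t2 g'_def)
    show ?thesis
    proof
      assume "eventually (\<lambda>\<omega>. el y \<omega> \<in> B \<omega>) W"
      then have "eventually (?below (el y) g') W" using inB by simp
      with g'_h tree have "eventually (?below (el y) (el h)) W"
        by eventually_elim (rule level_tree_trans(1))
      then have "(\<rho> y, \<rho> h) \<in> L" using L[OF y h(1)] by simp
      then show "\<rho> y \<in> b" using branch_downward[OF lt br] h(2) by blast
    next
      assume yb: "\<rho> y \<in> b"
      \<comment> \<open>Both \<open>y\<close> and \<open>g'\<close> lie below \<open>h\<close>, so
        they are comparable. As \<open>level_ub (\<pi> i1)\<close> bounds the level of
        \<open>y\<close> but not that of \<open>g'\<close>, this places \<open>y\<close> below
        \<open>g'\<close>.\<close>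
      have y_h: "eventually (?below (el y) (el h)) W"
      proof (rule above[OF Y(2)])
        show "a < j" if "a \<in> Y" for a
          using i3[of a] that j(1) by (auto intro: less_le_trans)
      qed (use Y s(2) h y yb in \<open>auto simp: el_in intro: branch_tU branch_comparable\<close>)
      have nb': "eventually (?nb g' (\<pi> i1)) W"
      proof -
        \<comment> \<open>Unlike \<open>\<pi>2\<close>, this renaming also moves \<open>i1\<close>,
          turning \<open>level_ub i1\<close> into \<open>level_ub (\<pi> i1)\<close>; on the
          coordinates of \<open>g\<close> the two agree.\<close>
        define \<pi>3 where "\<pi>3 i = (if i \<in> insert i1 r then \<pi> i else i)" for i
        have dep: "depends (s \<union> insert i1 r) (?nb (el g) i1)"
          unfolding depends_def
        proof (intro allI impI)
          fix S and x x' :: "nat suc \<Rightarrow> 'a set" assume eq: "\<forall>i\<in>s \<union> insert i1 r. x i = x' i"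
          then have t': "t (S, x) = t (S, x')" using t_cong[of x x' S] by simp
          moreover have "level_ub i1 (S, x) = level_ub i1 (S, x')" using t' eq by (intro level_ub_cong) auto
          ultimately show "?nb (el g) i1 (S, x) = ?nb (el g) i1 (S, x')"
            using eq dependsD[OF dep_g, of x x' S] by simp
        qed
        have i1s: "i1 \<notin> s" using i1 by blast
        have mono: "strict_mono_on (s \<union> insert i1 r) \<pi>3"
          unfolding strict_mono_on_def
        proof (intro allI impI, elim conjE)
          fix a c assume ac: "a \<in> s \<union> insert i1 r" "c \<in> s \<union> insert i1 r" "a < c"
          consider "a \<in> insert i1 r" "c \<in> insert i1 r" | "a \<in> insert i1 r" "c \<in> s" "c \<notin> insert i1 r"
            | "a \<in> s" "a \<notin> insert i1 r" "c \<in> insert i1 r" | "a \<notin> insert i1 r" "c \<notin> insert i1 r" using ac by blast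
          then show "\<pi>3 a < \<pi>3 c"
          proof cases
            case 1
            then show ?thesis using \<pi>(1) ac(3) unfolding \<pi>3_def strict_mono_on_def by simp
          next
            case 2
            have "i1 \<le> a" using 2(1) r(2)[of a] by auto
            then show ?thesis using i1[OF 2(2)] ac(3) by simp
          next
            case 3
            then show ?thesis using Y\<pi>[of a c] Y(3) by (auto simp: \<pi>3_def)
          next
            case 4
            then show ?thesis using ac(3) by (simp add: \<pi>3_def)
          qed
        qed
        from eventually_iter_filter_rename[OF ultra_E ultra_D _ mono dep] nb1
        have "eventually (\<lambda>\<omega>. ?nb (el g) i1 (fst \<omega>, \<lambda>i. snd \<omega> (\<pi>3 i))) W"
          using s(1) r(1) by simp
        moreover have "t (fst \<omega>, \<lambda>i. snd \<omega> (\<pi>3 i)) = t \<omega>" for \<omega>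
          using t_cong[of "\<lambda>i. snd \<omega> (\<pi>3 i)" "snd \<omega>" "fst \<omega>"] s_r i1s by (auto simp: \<pi>3_def)
        moreover from this have "level_ub i1 (fst \<omega>, \<lambda>i. snd \<omega> (\<pi>3 i)) = level_ub (\<pi> i1) \<omega>" for \<omega>
          by (intro level_ub_cong) (simp_all add: \<pi>3_def)
        moreover have "el g (fst \<omega>, \<lambda>i. snd \<omega> (\<pi>3 i)) = g' \<omega>" for \<omega>
          unfolding g'_def
          by (rule dependsD[OF dep_g]) (use i1s in \<open>auto simp: \<pi>2_def \<pi>3_def\<close>)
        ultimately show ?thesis by simp
      qed
      have "eventually (\<lambda>\<omega>. el y \<omega> = g' \<omega> \<or> ?below (el y) g' \<omega> \<or> ?below g' (el y) \<omega>) W"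
        using tree y_h g'_h by eventually_elim (rule level_tree_below)
      then have "eventually (?below (el y) g') W"
        using Y(1,3) s(2) Y\<pi>[of _ i1] y yb nb'
        by (intro above[OF Y(2)]) (auto simp: el_in intro: branch_tU)
      then show "eventually (\<lambda>\<omega>. el y \<omega> \<in> B \<omega>) W" using inB by simp
    qed
  qed
  have "b \<subseteq> \<rho> ` CC" using branch_D(1) UV(1) by blast
  then have "b = rset B" using main unfolding rset_def by blast
  moreover have "\<forall>\<omega>. B \<omega> \<subseteq> univ (M (fst \<omega>))" by (auto simp: B_def)
  ultimately show ?thesis using \<open>B \<in> CC\<close> by blast
qed

end

end


subsection \<open>Los's theorem\<close>

lemma case_nat_nth: "case_nat a ((!) l) = (!) (a # l)"
  by (rule ext) (simp split: nat.split)

section \<open>Closure of the family under Skolem functions and definable sets\<close>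

context iterated_power
begin

lemma fun_in: "set as \<subseteq> univ (M S) \<Longrightarrow> fun_int (M S) f as \<in> univ (M S)"
  using struct_M[of S] by (simp add: is_struct_def)

lemma CC_univ: "(\<lambda>\<omega>. univ (M (fst \<omega>))) \<in> CC"
  using CC_pw[of hU "[]" "[]" "[]"] by (simp add: Hs_def hU_def[abs_def])

lemma CC_fun:
  assumes "f \<in> Fs" "set cs \<subseteq> CC"
  shows "(\<lambda>\<omega>. {fun_int (M (fst \<omega>)) f (map (\<lambda>c. el c \<omega>) cs)}) \<in> CC"
  using CC_pw[of "hF f" cs "[]" "[]"] assms by (simp add: Hs_def hF_def[abs_def])

lemma CC_const: "c \<in> C \<Longrightarrow> (\<lambda>\<omega>. {c (fst \<omega>)}) \<in> CC"
  using CC_pw[of "hC c" "[]" "[]" "[]"] by (simp add: Hs_def hC_def[abs_def])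

lemma CC_sat:
  assumes "\<phi> \<in> \<Phi>" "set es \<subseteq> CC" "set bs \<subseteq> CC"
  shows "(\<lambda>\<omega>. {a \<in> univ (M (fst \<omega>)). sat (M (fst \<omega>)) ((!) (a # map (\<lambda>c. el c \<omega>) es)) ((!) (map (\<lambda>c. c \<omega>) bs)) \<phi>}) \<in> CC"
  using CC_pw[of "hE \<phi>" es bs "[]"] assms by (simp add: Hs_def hE_def[abs_def] case_nat_nth)

lemma CC_ev:
  assumes "q \<in> \<Phi>" "set cs \<subseteq> CC" "set es \<subseteq> CC" "set bs \<subseteq> CC" "B \<in> CC"
  shows "(\<lambda>\<omega>. {a \<in> univ (M (fst \<omega>)). ev (univ (M (fst \<omega>)))
    (fm_tree (M (fst \<omega>)) ((!) (map (\<lambda>c. el c \<omega>) es)) ((!) (map (\<lambda>c. c \<omega>) bs)) (B \<omega>) q)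
    (a # map (\<lambda>c. el c \<omega>) cs) \<beta>}) \<in> CC"
proof -
  have "(q, \<beta>, length cs) \<in> \<Phi> \<times> UNIV \<times> UNIV" using assms(1) by simp
  then have "hB q \<beta> (length cs) \<in> Hs" 
    unfolding Hs_def by (intro UnI2) (rule image_eqI[of _ _ "(q, \<beta>, length cs)"], simp_all)
  then show ?thesis
    using CC_pw[of "hB q \<beta> (length cs)" "cs @ es" "B # bs" "[]"] assms by (simp add: hB_def[abs_def])
qed

lemma CC_bounds:
  assumes "q \<in> \<Phi>" "set es \<subseteq> CC" "set bs \<subseteq> CC"
  shows "(\<lambda>\<omega>. bounds (fm_tree (M (fst \<omega>)) ((!) (map (\<lambda>c. el c \<omega>) es)) ((!) (map (\<lambda>c. c \<omega>) bs)) {} q) (snd \<omega> i)) \<in> CC"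
  using CC_pw[of "hV q" es bs "[i]"] assms by (simp add: Hs_def hV_def[abs_def])

lemma CC_branch:
  assumes "q \<in> \<Phi>" "set es \<subseteq> CC" "set bs \<subseteq> CC"
  shows "(\<lambda>\<omega>. SOME b. is_branch (fm_tree (M (fst \<omega>)) ((!) (map (\<lambda>c. el c \<omega>) es)) ((!) (map (\<lambda>c. c \<omega>) bs)) {} q) b \<and>
     sat (M (fst \<omega>)) ((!) (map (\<lambda>c. el c \<omega>) es)) ((!) (b # map (\<lambda>c. c \<omega>) bs)) (fm_body q)) \<in> CC"
  using CC_pw[of "hQ q" es bs "[]"] assms by (simp add: Hs_def hQ_def[abs_def] case_nat_nth)

lemma CC_list_depends:
  assumes "set cs \<subseteq> CC"
  shows "\<exists>A. finite A \<and> (\<forall>c\<in>set cs. depends A c)"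
  using assms
proof (induction cs)
  case (Cons c cs)
  then obtain A A' where "finite A" "\<forall>c\<in>set cs. depends A c" "finite A'" "depends A' c"
    using CC_depends[of c] by auto
  then show ?case by (intro exI[of _ "A \<union> A'"]) (auto intro: depends_mono)
qed auto

end

section \<open>The ultrapower \<open>N\<close>, its terms and its trees\<close>

context iterated_model
begin

text \<open>Symbols are evaluated on representatives chosen by \<open>inv_into\<close>. A function
  symbol outside \<open>Fs\<close>, or applied outside the universe, takes a default element as its
  value, which keeps \<open>N\<close> a structure.\<close>

definition N :: "('f, 'p, 'k) struct" where
  "N = \<lparr>univ = \<rho> ` CC,
    fun_int = (\<lambda>f as. if f \<in> Fs \<and> set as \<subseteq> \<rho> ` CC
      then \<rho> (\<lambda>\<omega>. {fun_int (M (fst \<omega>)) f (map (\<lambda>c. el c \<omega>) (map (inv_into CC \<rho>) as))})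
      else \<rho> (\<lambda>\<omega>. univ (M (fst \<omega>)))),
    rel_int = (\<lambda>p as. eventually (\<lambda>\<omega>. rel_int (M (fst \<omega>)) p (map (\<lambda>c. el c \<omega>) (map (inv_into CC \<rho>) as))) W)\<rparr>"

lemma univ_N: "univ N = \<rho> ` CC"
  by (simp add: N_def)

lemma struct_N: "is_struct N"
proof -
  have "fun_int N f as \<in> univ N" for f as
  proof (cases "f \<in> Fs \<and> set as \<subseteq> \<rho> ` CC")
    case True
    then have "set (map (inv_into CC \<rho>) as) \<subseteq> CC" by (auto intro: inv_into_into)
    from CC_fun[OF _ this, of f] True show ?thesis by (simp add: N_def)
  qed (auto simp: N_def CC_univ)
  then show ?thesis using CC_univ by (auto simp: is_struct_def univ_N)
qed

lemma inv_CC: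
  assumes "set cs \<subseteq> CC"
  shows "set (map (inv_into CC \<rho>) (map \<rho> cs)) \<subseteq> CC"
proof
  fix x assume "x \<in> set (map (inv_into CC \<rho>) (map \<rho> cs))"
  then obtain c where "c \<in> set cs" "x = inv_into CC \<rho> (\<rho> c)" by auto
  then show "x \<in> CC" using assms inv_into_into[of "\<rho> c" \<rho> CC] by auto
qed

text \<open>The chosen representatives agree with the given functions almost everywhere, so the
  interpretations in \<open>N\<close> are independent of the choice.\<close>

lemma inv_\<rho>:
  assumes "set cs \<subseteq> CC"
  shows "eventually (\<lambda>\<omega>. map (\<lambda>c. el c \<omega>) (map (inv_into CC \<rho>) (map \<rho> cs)) = map (\<lambda>c. el c \<omega>) cs) W"
  using assms
proof (induction cs)
  case (Cons c cs)
  have "inv_into CC \<rho> (\<rho> c) \<in> CC" "\<rho> (inv_into CC \<rho> (\<rho> c)) = \<rho> c"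
    using Cons.prems inv_into_into[of "\<rho> c" \<rho> CC] f_inv_into_f[of "\<rho> c" \<rho> CC] by auto
  then have "eventually (\<lambda>\<omega>. el (inv_into CC \<rho> (\<rho> c)) \<omega> = el c \<omega>) W"
    using \<rho>[of "inv_into CC \<rho> (\<rho> c)" c] Cons.prems by simp
  moreover have "eventually (\<lambda>\<omega>. map (\<lambda>c. el c \<omega>) (map (inv_into CC \<rho>) (map \<rho> cs)) = map (\<lambda>c. el c \<omega>) cs) W"
    using Cons by simp
  ultimately show ?case by eventually_elim simp
qed simp

lemma val_N:
  assumes "set es \<subseteq> CC"
  shows "closed_tm (length es) t \<Longrightarrow> funs_tm t \<subseteq> Fs \<Longrightarrow>
    \<exists>c\<in>CC. val N ((!) (map \<rho> es)) t = \<rho> c \<and>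
      eventually (\<lambda>\<omega>. el c \<omega> = val (M (fst \<omega>)) ((!) (map (\<lambda>c. el c \<omega>) es)) t) W"
proof (induction t)
  case (Var i)
  then show ?case using assms by (intro bexI[of _ "es ! i"]) auto
next
  case (Fn f ts)
  let ?Q = "\<lambda>t c. c \<in> CC \<and> val N ((!) (map \<rho> es)) t = \<rho> c \<and>
      eventually (\<lambda>\<omega>. el c \<omega> = val (M (fst \<omega>)) ((!) (map (\<lambda>c. el c \<omega>) es)) t) W"
  have "\<forall>t\<in>set ts. \<exists>c. ?Q t c"
  proof
    fix t assume t: "t \<in> set ts"
    then have "closed_tm (length es) t" "funs_tm t \<subseteq> Fs"
      using Fn.prems by (auto simp: list_all_iff)
    then show "\<exists>c. ?Q t c" using Fn.IH[OF t] by blast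
  qed
  from bchoice[OF this] obtain g where g: "\<forall>t\<in>set ts. ?Q t (g t)" ..
  let ?cs = "map g ts"
  let ?c = "\<lambda>cs \<omega>. {fun_int (M (fst \<omega>)) f (map (\<lambda>c. el c \<omega>) cs)}"
  have cs: "set ?cs \<subseteq> CC" using g by auto
  have f: "f \<in> Fs" using Fn.prems by simp
  have el: "el (?c cs) \<omega> = fun_int (M (fst \<omega>)) f (map (\<lambda>c. el c \<omega>) cs)" for cs \<omega>
  proof -
    have "fun_int (M (fst \<omega>)) f (map (\<lambda>c. el c \<omega>) cs) \<in> univ (M (fst \<omega>))"
      by (rule fun_in) (auto simp: el_in)
    then show ?thesis unfolding el_def[of "?c cs"] by (rule pick_singleton)
  qed
  have map: "map (val N ((!) (map \<rho> es))) ts = map \<rho> ?cs" using g by simp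
  have "eventually (\<lambda>\<omega>. el (?c (map (inv_into CC \<rho>) (map \<rho> ?cs))) \<omega> = el (?c ?cs) \<omega>) W"
    unfolding el using inv_\<rho>[OF cs] by eventually_elim (rule arg_cong)
  then have "\<rho> (?c (map (inv_into CC \<rho>) (map \<rho> ?cs))) = \<rho> (?c ?cs)"
    using \<rho>[OF CC_fun[OF f inv_CC[OF cs]] CC_fun[OF f cs]] by simp
  then have "val N ((!) (map \<rho> es)) (Fn f ts) = \<rho> (?c ?cs)"
    using f cs unfolding val.simps map by (auto simp: N_def)
  moreover have "eventually (\<lambda>\<omega>. map (\<lambda>c. el c \<omega>) ?cs = map (val (M (fst \<omega>)) ((!) (map (\<lambda>c. el c \<omega>) es))) ts) W"
    using g
  proof (induction ts)
    case (Cons t ts)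
    then have "eventually (\<lambda>\<omega>. el (g t) \<omega> = val (M (fst \<omega>)) ((!) (map (\<lambda>c. el c \<omega>) es)) t) W"
      "eventually (\<lambda>\<omega>. map (\<lambda>c. el c \<omega>) (map g ts) = map (val (M (fst \<omega>)) ((!) (map (\<lambda>c. el c \<omega>) es))) ts) W"
      by simp_all
    then show ?case by eventually_elim simp
  qed simp
  then have "eventually (\<lambda>\<omega>. el (?c ?cs) \<omega> = val (M (fst \<omega>)) ((!) (map (\<lambda>c. el c \<omega>) es)) (Fn f ts)) W"
    unfolding el val.simps by eventually_elim (rule arg_cong)
  ultimately show ?case using CC_fun[OF f cs] by blast
qed

lemma vals_N:
  assumes es: "set es \<subseteq> CC" and ts: "list_all (closed_tm (length es)) ts" "(\<Union>t\<in>set ts. funs_tm t) \<subseteq> Fs"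
  shows "\<exists>cs. set cs \<subseteq> CC \<and> map (val N ((!) (map \<rho> es))) ts = map \<rho> cs \<and>
      eventually (\<lambda>\<omega>. map (\<lambda>c. el c \<omega>) cs = map (val (M (fst \<omega>)) ((!) (map (\<lambda>c. el c \<omega>) es))) ts) W"
  using ts
proof (induction ts)
  case (Cons t ts)
  then obtain cs where cs: "set cs \<subseteq> CC" "map (val N ((!) (map \<rho> es))) ts = map \<rho> cs"
      and 1: "eventually (\<lambda>\<omega>. map (\<lambda>c. el c \<omega>) cs = map (val (M (fst \<omega>)) ((!) (map (\<lambda>c. el c \<omega>) es))) ts) W"
    by auto
  obtain c where c: "c \<in> CC" "val N ((!) (map \<rho> es)) t = \<rho> c"
    and 2: "eventually (\<lambda>\<omega>. el c \<omega> = val (M (fst \<omega>)) ((!) (map (\<lambda>c. el c \<omega>) es)) t) W"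
    using val_N[OF es, of t] Cons.prems by auto
  from 1 2 have "eventually (\<lambda>\<omega>. map (\<lambda>c. el c \<omega>) (c # cs) = map (val (M (fst \<omega>)) ((!) (map (\<lambda>c. el c \<omega>) es))) (t # ts)) W"
    by eventually_elim simp
  then show ?case using c cs by (intro exI[of _ "c # cs"]) auto
qed auto

text \<open>\<open>c\<close> collects the witnesses at each point, so \<open>el c\<close> is a
  Skolem function that finds one wherever it exists.\<close>

lemma ex_los:
  assumes c: "c \<in> CC" and P: "\<And>d. d \<in> CC \<Longrightarrow> P (\<rho> d) \<longleftrightarrow> eventually (\<lambda>\<omega>. Q \<omega> (el d \<omega>)) W"
    and cQ: "\<And>\<omega> a. a \<in> univ (M (fst \<omega>)) \<Longrightarrow> a \<in> c \<omega> \<longleftrightarrow> Q \<omega> a"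
  shows "(\<exists>a\<in>univ N. P a) \<longleftrightarrow> eventually (\<lambda>\<omega>. \<exists>a\<in>univ (M (fst \<omega>)). Q \<omega> a) W"
proof
  assume "\<exists>a\<in>univ N. P a"
  then obtain d where "d \<in> CC" "eventually (\<lambda>\<omega>. Q \<omega> (el d \<omega>)) W" using P by (auto simp: univ_N)
  then show "eventually (\<lambda>\<omega>. \<exists>a\<in>univ (M (fst \<omega>)). Q \<omega> a) W"
    using el_in by (auto elim!: eventually_mono)
next
  assume "eventually (\<lambda>\<omega>. \<exists>a\<in>univ (M (fst \<omega>)). Q \<omega> a) W"
  then have "eventually (\<lambda>\<omega>. Q \<omega> (el c \<omega>)) W"
  proof eventually_elim
    case (elim \<omega>)
    then obtain a where "a \<in> univ (M (fst \<omega>))" "a \<in> c \<omega>" using cQ by blast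
    then have "el c \<omega> \<in> c \<omega>" unfolding el_def by (intro pick_mem)
    then show ?case using cQ el_in by blast
  qed
  then show "\<exists>a\<in>univ N. P a" using P[OF c] c by (auto simp: univ_N)
qed

text \<open>The hypothesis \<open>ev\<close> supplies the Skolem functions for \<open>BEx\<close>.
  The result transfers \<open>level_tree_bf\<close> and \<open>branch_bf\<close> between
  \<open>N\<close> and the given structures.\<close>

lemma bf_los:
  assumes U: "\<And>c. c \<in> CC \<Longrightarrow> \<rho> c \<in> tU tN \<longleftrightarrow> eventually (\<lambda>\<omega>. el c \<omega> \<in> tU (t \<omega>)) W"
    and V: "\<And>c. c \<in> CC \<Longrightarrow> \<rho> c \<in> tV tN \<longleftrightarrow> eventually (\<lambda>\<omega>. el c \<omega> \<in> tV (t \<omega>)) W"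
    and B: "\<And>c. c \<in> CC \<Longrightarrow> \<rho> c \<in> tB tN \<longleftrightarrow> eventually (\<lambda>\<omega>. el c \<omega> \<in> tB (t \<omega>)) W"
    and L: "\<And>c d. c \<in> CC \<Longrightarrow> d \<in> CC \<Longrightarrow> (\<rho> c, \<rho> d) \<in> tL tN \<longleftrightarrow> eventually (\<lambda>\<omega>. (el c \<omega>, el d \<omega>) \<in> tL (t \<omega>)) W"
    and M': "\<And>c d. c \<in> CC \<Longrightarrow> d \<in> CC \<Longrightarrow> (\<rho> c, \<rho> d) \<in> tM tN \<longleftrightarrow> eventually (\<lambda>\<omega>. (el c \<omega>, el d \<omega>) \<in> tM (t \<omega>)) W"
    and R: "\<And>c d. c \<in> CC \<Longrightarrow> d \<in> CC \<Longrightarrow> (\<rho> c, \<rho> d) \<in> tR tN \<longleftrightarrow> eventually (\<lambda>\<omega>. (el c \<omega>, el d \<omega>) \<in> tR (t \<omega>)) W"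
    and ev: "\<And>cs \<beta>. set cs \<subseteq> CC \<Longrightarrow>
      (\<lambda>\<omega>. {a \<in> univ (M (fst \<omega>)). ev (univ (M (fst \<omega>))) (t \<omega>) (a # map (\<lambda>c. el c \<omega>) cs) \<beta>}) \<in> CC"
  shows "closed_bf (length cs) \<beta> \<Longrightarrow> set cs \<subseteq> CC \<Longrightarrow>
    ev (univ N) tN (map \<rho> cs) \<beta> \<longleftrightarrow> eventually (\<lambda>\<omega>. ev (univ (M (fst \<omega>))) (t \<omega>) (map (\<lambda>c. el c \<omega>) cs) \<beta>) W"
proof (induction \<beta> arbitrary: cs)
  case (BNeg \<beta>)
  then show ?case by (simp add: ultra_not[OF ultra_W])
next
  case (BAnd \<beta> \<gamma>)
  then show ?case by (simp add: eventually_conj_iff)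
next
  case (BEx \<beta>)
  have "(\<exists>a\<in>univ N. ev (univ N) tN (a # map \<rho> cs) \<beta>) \<longleftrightarrow>
    eventually (\<lambda>\<omega>. \<exists>a\<in>univ (M (fst \<omega>)). ev (univ (M (fst \<omega>))) (t \<omega>) (a # map (\<lambda>c. el c \<omega>) cs) \<beta>) W"
    by (rule ex_los[OF ev[OF BEx.prems(2)], where \<beta>1 = \<beta>]) (use BEx.IH[of "_ # cs"] BEx.prems in auto)
  then show ?case by simp
qed (auto simp: U V B L M' R \<rho> subset_iff)

end


section \<open>Los's theorem with the branch quantifier\<close>

context iterated_model
begin

abbreviation ele :: "(('s, 'a) point \<Rightarrow> 'a set) list \<Rightarrow> ('s, 'a) point \<Rightarrow> nat \<Rightarrow> 'a" where
  "ele es \<omega> \<equiv> (!) (map (\<lambda>c. el c \<omega>) es)"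

abbreviation eva :: "(('s, 'a) point \<Rightarrow> 'a set) list \<Rightarrow> ('s, 'a) point \<Rightarrow> nat \<Rightarrow> 'a set" where
  "eva bs \<omega> \<equiv> (!) (map (\<lambda>c. c \<omega>) bs)"

text \<open>Branch variables take internal sets as values. For the branch quantifier,
  \<open>bf_los\<close> transfers being a level-tree and being a branch. By
  \<open>branch_definable\<close> every branch of \<open>N\<close> is internal; conversely, branches
  chosen pointwise by a member of the family form a branch of \<open>N\<close>.\<close>

lemma los:
  "\<lbrakk>subf \<phi> \<subseteq> \<Phi>; funs_fm \<phi> \<subseteq> Fs; closed_fm (length es) (length bs) \<phi>; set es \<subseteq> CC; set bs \<subseteq> CC\<rbrakk> \<Longrightarrow>
    sat N ((!) (map \<rho> es)) ((!) (map rset bs)) \<phi> \<longleftrightarrow>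
      eventually (\<lambda>\<omega>. sat (M (fst \<omega>)) (ele es \<omega>) (eva bs \<omega>) \<phi>) W"
proof (induction \<phi> arbitrary: es bs)
  case (Eq t u)
  obtain c d where c: "c \<in> CC" "val N ((!) (map \<rho> es)) t = \<rho> c"
      "eventually (\<lambda>\<omega>. el c \<omega> = val (M (fst \<omega>)) (ele es \<omega>) t) W"
    and d: "d \<in> CC" "val N ((!) (map \<rho> es)) u = \<rho> d"
      "eventually (\<lambda>\<omega>. el d \<omega> = val (M (fst \<omega>)) (ele es \<omega>) u) W"
    using val_N[of es t] val_N[of es u] Eq.prems by auto
  have "eventually (\<lambda>\<omega>. (el c \<omega> = el d \<omega>) = (val (M (fst \<omega>)) (ele es \<omega>) t = val (M (fst \<omega>)) (ele es \<omega>) u)) W"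
    using c(3) d(3) by eventually_elim simp
  then show ?case using c d by (simp add: \<rho> eventually_subst)
next
  case (Rel p ts)
  obtain cs where cs: "set cs \<subseteq> CC" "map (val N ((!) (map \<rho> es))) ts = map \<rho> cs"
      "eventually (\<lambda>\<omega>. map (\<lambda>c. el c \<omega>) cs = map (val (M (fst \<omega>)) (ele es \<omega>)) ts) W"
    using vals_N[of es ts] Rel.prems by auto
  have "eventually (\<lambda>\<omega>. rel_int (M (fst \<omega>)) p (map (\<lambda>c. el c \<omega>) (map (inv_into CC \<rho>) (map \<rho> cs)))
      = rel_int (M (fst \<omega>)) p (map (val (M (fst \<omega>)) (ele es \<omega>)) ts)) W"
    using cs(3) inv_\<rho>[OF cs(1)] by eventually_elim (simp only:)
  from eventually_subst[OF this] show ?case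
    unfolding sat.simps cs(2) by (simp add: N_def comp_assoc)
next
  case (InBr i t)
  obtain c where c: "c \<in> CC" "val N ((!) (map \<rho> es)) t = \<rho> c"
      "eventually (\<lambda>\<omega>. el c \<omega> = val (M (fst \<omega>)) (ele es \<omega>) t) W"
    using val_N[of es t] InBr.prems by auto
  have "eventually (\<lambda>\<omega>. (el c \<omega> \<in> (bs ! i) \<omega>) = (val (M (fst \<omega>)) (ele es \<omega>) t \<in> (bs ! i) \<omega>)) W"
    using c(3) by eventually_elim simp
  then show ?case using c InBr.prems by (simp add: \<rho>_in_rset eventually_subst)
next
  case (Neg \<phi>)
  then show ?case by (simp add: ultra_not[OF ultra_W])
next
  case (And \<phi> \<psi>)
  then show ?case by (simp add: eventually_conj_iff)
next
  case (Ex \<phi>)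
  have \<phi>: "\<phi> \<in> \<Phi>" using Ex.prems(1) self_in_subf[of \<phi>] by auto
  have "(\<exists>a\<in>univ N. sat N ((!) (a # map \<rho> es)) ((!) (map rset bs)) \<phi>) \<longleftrightarrow>
      eventually (\<lambda>\<omega>. \<exists>a\<in>univ (M (fst \<omega>)). sat (M (fst \<omega>)) ((!) (a # map (\<lambda>c. el c \<omega>) es)) (eva bs \<omega>) \<phi>) W"
    by (rule ex_los[OF CC_sat[OF \<phi> Ex.prems(4,5)]]) (use Ex.IH[of "_ # es" bs] Ex.prems in auto)
  then show ?case by (simp add: case_nat_nth)
next
  case (QBrch \<phi>1 \<phi>2 \<psi>1 \<psi>2 \<rho>' \<Theta>)
  define q where "q = QBrch \<phi>1 \<phi>2 \<psi>1 \<psi>2 \<rho>' \<Theta>"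
  have es: "set es \<subseteq> CC" and bs: "set bs \<subseteq> CC" using QBrch.prems by auto
  have \<Phi>: "q \<in> \<Phi>" "\<psi>1 \<in> \<Phi>" using QBrch.prems(1) self_in_subf[of \<psi>1] by (auto simp: q_def)
  define tt where "tt B \<omega> = fm_tree (M (fst \<omega>)) (ele es \<omega>) (eva bs \<omega>) (B \<omega>) q" for B \<omega>
  define tN where "tN B = fm_tree N ((!) (map \<rho> es)) ((!) (map rset bs)) (rset B) q" for B
  have U: "\<rho> c \<in> tU (tN B) \<longleftrightarrow> eventually (\<lambda>\<omega>. el c \<omega> \<in> tU (tt B' \<omega>)) W"
    and V: "\<rho> c \<in> tV (tN B) \<longleftrightarrow> eventually (\<lambda>\<omega>. el c \<omega> \<in> tV (tt B' \<omega>)) W" if "c \<in> CC" for c B B'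
    using QBrch.IH(1)[of "c # es" bs] QBrch.IH(2)[of "c # es" bs] QBrch.prems that
    by (simp_all add: tN_def tt_def fm_tree_def q_def univ_N el_in case_nat_nth)
  have L: "(\<rho> c, \<rho> d) \<in> tL (tN B) \<longleftrightarrow> eventually (\<lambda>\<omega>. (el c \<omega>, el d \<omega>) \<in> tL (tt B' \<omega>)) W"
    and M': "(\<rho> c, \<rho> d) \<in> tM (tN B) \<longleftrightarrow> eventually (\<lambda>\<omega>. (el c \<omega>, el d \<omega>) \<in> tM (tt B' \<omega>)) W"
    and R: "(\<rho> c, \<rho> d) \<in> tR (tN B) \<longleftrightarrow> eventually (\<lambda>\<omega>. (el c \<omega>, el d \<omega>) \<in> tR (tt B' \<omega>)) W"
    if "c \<in> CC" "d \<in> CC" for c d B B'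
    using QBrch.IH(3)[of "c # d # es" bs] QBrch.IH(4)[of "c # d # es" bs] QBrch.IH(5)[of "c # d # es" bs]
      QBrch.prems that
    by (simp_all add: tN_def tt_def fm_tree_def q_def univ_N el_in case_nat_nth)
  have B: "tB (tN B) = rset B" "tB (tt B \<omega>) = B \<omega>" for B \<omega>
    by (simp_all add: tN_def tt_def fm_tree_def q_def)
  have same: "tU (tN B) = tU (tN B')" "tV (tN B) = tV (tN B')" "tL (tN B) = tL (tN B')"
      "tM (tN B) = tM (tN B')" "tR (tN B) = tR (tN B')"
      "tU (tt B \<omega>) = tU (tt B' \<omega>)" "tV (tt B \<omega>) = tV (tt B' \<omega>)" "tL (tt B \<omega>) = tL (tt B' \<omega>)"
      "tM (tt B \<omega>) = tM (tt B' \<omega>)" "tR (tt B \<omega>) = tR (tt B' \<omega>)" for B B' \<omega>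
    by (simp_all add: tN_def tt_def fm_tree_def q_def)
  have bf: "ev (univ N) (tN B) [] \<beta> \<longleftrightarrow> eventually (\<lambda>\<omega>. ev (univ (M (fst \<omega>))) (tt B \<omega>) [] \<beta>) W"
    if "B \<in> CC" "closed_bf 0 \<beta>" for B \<beta>
  proof -
    have "ev (univ N) (tN B) (map \<rho> []) \<beta> \<longleftrightarrow>
      eventually (\<lambda>\<omega>. ev (univ (M (fst \<omega>))) (tt B \<omega>) (map (\<lambda>c. el c \<omega>) []) \<beta>) W"
    proof (rule bf_los[OF U V _ L M' R])
      show "(\<lambda>\<omega>. {a \<in> univ (M (fst \<omega>)). ev (univ (M (fst \<omega>))) (tt B \<omega>) (a # map (\<lambda>c. el c \<omega>) cs) \<beta>}) \<in> CC"
        if "set cs \<subseteq> CC" for cs \<beta>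
        unfolding tt_def by (rule CC_ev[OF \<Phi>(1) that es bs \<open>B \<in> CC\<close>])
    qed (use that in \<open>simp_all add: B \<rho>_in_rset\<close>)
    then show ?thesis by simp
  qed
  have in_tN: "ltree_in (univ N) (tN B)" and in_tt: "ltree_in (univ (M (fst \<omega>))) (tt B \<omega>)" for B \<omega>
    by (simp_all add: tN_def tt_def ltree_in_fm_tree)
  \<comment> \<open>The five tree components do not change with the distinguished set, so the empty
    set can act as a placeholder; the transfer itself uses the universe, which is known to be in
    \<open>CC\<close>.\<close>
  define B0 :: "('s, 'a) point \<Rightarrow> 'a set" where "B0 = (\<lambda>\<omega>. {})"
  have tree: "is_level_tree (tN B0) \<longleftrightarrow> eventually (\<lambda>\<omega>. is_level_tree (tt B0 \<omega>)) W"
    using bf[OF CC_univ closed_level_tree_bf] ev_level_tree[OF in_tN] ev_level_tree[OF in_tt]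
      same[where B = "\<lambda>\<omega>. univ (M (fst \<omega>))" and B' = B0] by simp
  \<comment> \<open>\<open>B\<close> is tested as the distinguished set of its own tree. Its
    inclusion in the universe is assumed almost everywhere only, so that sets chosen by
    \<open>SOME\<close> are covered.\<close>
  have branch: "is_branch (tN B0) (rset B) \<longleftrightarrow> eventually (\<lambda>\<omega>. is_branch (tt B0 \<omega>) (B \<omega>)) W"
    if "B \<in> CC" and sub: "eventually (\<lambda>\<omega>. B \<omega> \<subseteq> univ (M (fst \<omega>))) W" for B
  proof -
    have "rset B \<subseteq> univ N" by (auto simp: rset_def univ_N)
    then have "is_branch (tN B0) (rset B) \<longleftrightarrow> eventually (\<lambda>\<omega>. ev (univ (M (fst \<omega>))) (tt B \<omega>) [] branch_bf) W"
      using bf[OF \<open>B \<in> CC\<close> closed_branch_bf] ev_branch[OF in_tN[of B]] same[where B = B0 and B' = B] by (simp add: B)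
    also have "\<dots> \<longleftrightarrow> eventually (\<lambda>\<omega>. is_branch (tt B0 \<omega>) (B \<omega>)) W"
    proof (rule eventually_subst)
      show "eventually (\<lambda>\<omega>. ev (univ (M (fst \<omega>))) (tt B \<omega>) [] branch_bf = is_branch (tt B0 \<omega>) (B \<omega>)) W"
        using sub
      proof eventually_elim
        case (elim \<omega>)
        then show ?case using ev_branch[OF in_tt[of \<omega> B]] same[where B = B0 and B' = B] by (simp add: B)
      qed
    qed
    finally show ?thesis .
  qed
  have body: "sat N ((!) (map \<rho> es)) ((!) (rset B # map rset bs)) \<Theta> \<longleftrightarrow>
      eventually (\<lambda>\<omega>. sat (M (fst \<omega>)) (ele es \<omega>) ((!) (B \<omega> # map (\<lambda>c. c \<omega>) bs)) \<Theta>) W" if "B \<in> CC" for B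
    using QBrch.IH(6)[of es "B # bs"] QBrch.prems that by simp
  have satN: "sat N ((!) (map \<rho> es)) ((!) (map rset bs)) q \<longleftrightarrow> (is_level_tree (tN B0) \<longrightarrow>
      (\<exists>b. is_branch (tN B0) b \<and> sat N ((!) (map \<rho> es)) ((!) (b # map rset bs)) \<Theta>))"
    unfolding tN_def sat_QBrch[OF q_def, of N _ _ "rset B0"] by (simp add: case_nat_nth)
  have satM: "sat (M (fst \<omega>)) (ele es \<omega>) (eva bs \<omega>) q \<longleftrightarrow> (is_level_tree (tt B0 \<omega>) \<longrightarrow>
      (\<exists>b. is_branch (tt B0 \<omega>) b \<and> sat (M (fst \<omega>)) (ele es \<omega>) ((!) (b # map (\<lambda>c. c \<omega>) bs)) \<Theta>))" for \<omega>
    unfolding tt_def sat_QBrch[OF q_def, of "M (fst \<omega>)" _ _ "B0 \<omega>"] by (simp add: case_nat_nth)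
  have "sat N ((!) (map \<rho> es)) ((!) (map rset bs)) q \<longleftrightarrow>
      eventually (\<lambda>\<omega>. sat (M (fst \<omega>)) (ele es \<omega>) (eva bs \<omega>) q) W"
  proof (cases "is_level_tree (tN B0)")
    case False
    then have "eventually (\<lambda>\<omega>. \<not> is_level_tree (tt B0 \<omega>)) W"
      using tree ultra_not[OF ultra_W] by blast
    then have "eventually (\<lambda>\<omega>. sat (M (fst \<omega>)) (ele es \<omega>) (eva bs \<omega>) q) W"
      by eventually_elim (simp add: satM)
    then show ?thesis using False satN by simp
  next
    case True
    then have level: "eventually (\<lambda>\<omega>. is_level_tree (tt B0 \<omega>)) W" using tree by simp
    show ?thesis
    proof
      assume "sat N ((!) (map \<rho> es)) ((!) (map rset bs)) q"
      then obtain b where b: "is_branch (tN B0) b" "sat N ((!) (map \<rho> es)) ((!) (b # map rset bs)) \<Theta>"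
        using satN True by blast
      obtain A A' where A: "finite A" "\<forall>c\<in>set es. depends A c" "finite A'" "\<forall>c\<in>set bs. depends A' c"
        using CC_list_depends[OF es] CC_list_depends[OF bs] by blast
      have dep: "depends (A \<union> A') (tt B0)"
        unfolding depends_def
      proof (intro allI impI)
        fix S and x x' :: "nat suc \<Rightarrow> 'a set" assume eq: "\<forall>i\<in>A \<union> A'. x i = x' i"
        have "map (\<lambda>c. el c (S, x)) es = map (\<lambda>c. el c (S, x')) es"
          using A(2) eq by (auto intro!: dependsD[OF depends_el])
        moreover have "map (\<lambda>c. c (S, x)) bs = map (\<lambda>c. c (S, x')) bs"
          using A(4) eq by (auto intro!: dependsD)
        ultimately show "tt B0 (S, x) = tt B0 (S, x')" unfolding tt_def B0_def fst_conv by (simp only:)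
      qed
      have "\<exists>B\<in>CC. (\<forall>\<omega>. B \<omega> \<subseteq> univ (M (fst \<omega>))) \<and> b = rset B"
      proof (rule branch_definable[of "A \<union> A'" "tt B0" "tU (tN B0)" "tV (tN B0)" "tL (tN B0)" "tM (tN B0)" "tR (tN B0)"])
        \<comment> \<open>\<open>\<psi>1\<close> with the node \<open>g\<close> as its first
          parameter defines this set.\<close>
        show "(\<lambda>\<omega>. {a \<in> univ (M (fst \<omega>)). (a, el g \<omega>) \<in> tL (tt B0 \<omega>)}) \<in> CC" if "g \<in> CC" for g
          using CC_sat[OF \<Phi>(2), of "g # es" bs] that es bs
          by (simp add: tt_def fm_tree_def q_def case_nat_nth el_in cong: conj_cong)
        show "(\<lambda>\<omega>. bounds (tt B0 \<omega>) (snd \<omega> i)) \<in> CC" for i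
          using CC_bounds[OF \<Phi>(1) es bs] by (simp add: tt_def B0_def)
        show "tU (tN B0) \<subseteq> \<rho> ` CC" "tV (tN B0) \<subseteq> \<rho> ` CC"
          using in_tN[of B0] by (auto simp: ltree_in_def univ_N)
      qed (use A dep level in_tt U V L M' R True b in \<open>simp_all\<close>)
      then obtain B where B: "B \<in> CC" "\<forall>\<omega>. B \<omega> \<subseteq> univ (M (fst \<omega>))" "b = rset B" by blast
      have "eventually (\<lambda>\<omega>. is_branch (tt B0 \<omega>) (B \<omega>)) W"
        using branch[OF B(1)] B b(1) by simp
      moreover have "eventually (\<lambda>\<omega>. sat (M (fst \<omega>)) (ele es \<omega>) ((!) (B \<omega> # map (\<lambda>c. c \<omega>) bs)) \<Theta>) W"
        using body[OF B(1)] B b(2) by simp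
      ultimately show "eventually (\<lambda>\<omega>. sat (M (fst \<omega>)) (ele es \<omega>) (eva bs \<omega>) q) W"
        by eventually_elim (use satM in blast)
    next
      assume "eventually (\<lambda>\<omega>. sat (M (fst \<omega>)) (ele es \<omega>) (eva bs \<omega>) q) W"
      \<comment> \<open>A Skolem function for the branch quantifier. Its value is arbitrary where no
        suitable branch exists, which is excluded almost everywhere.\<close>
      define B where "B = (\<lambda>\<omega>. SOME b. is_branch (tt B0 \<omega>) b \<and>
        sat (M (fst \<omega>)) (ele es \<omega>) ((!) (b # map (\<lambda>c. c \<omega>) bs)) \<Theta>)"
      have "B \<in> CC"
        using CC_branch[OF \<Phi>(1) es bs] by (simp add: B_def tt_def B0_def fm_body_def q_def)
      have ev: "eventually (\<lambda>\<omega>. is_branch (tt B0 \<omega>) (B \<omega>) \<and>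
          sat (M (fst \<omega>)) (ele es \<omega>) ((!) (B \<omega> # map (\<lambda>c. c \<omega>) bs)) \<Theta>) W"
        using level \<open>eventually (\<lambda>\<omega>. sat (M (fst \<omega>)) (ele es \<omega>) (eva bs \<omega>) q) W\<close>
      proof eventually_elim
        case (elim \<omega>)
        then have "\<exists>b. is_branch (tt B0 \<omega>) b \<and> sat (M (fst \<omega>)) (ele es \<omega>) ((!) (b # map (\<lambda>c. c \<omega>) bs)) \<Theta>"
          using satM by blast
        then show ?case unfolding B_def by (rule someI_ex)
      qed
      then have "eventually (\<lambda>\<omega>. B \<omega> \<subseteq> univ (M (fst \<omega>))) W"
      proof eventually_elim
        case (elim \<omega>)
        then have "B \<omega> \<subseteq> tU (tt B0 \<omega>)" unfolding branch_def by blast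
        then show ?case using in_tt[of \<omega> B0] unfolding ltree_in_def by blast
      qed
      then have "is_branch (tN B0) (rset B)" using branch[OF \<open>B \<in> CC\<close>] ev by (simp add: eventually_conj_iff)
      moreover have "sat N ((!) (map \<rho> es)) ((!) (rset B # map rset bs)) \<Theta>"
        using body[OF \<open>B \<in> CC\<close>] ev by (simp add: eventually_conj_iff)
      ultimately show "sat N ((!) (map \<rho> es)) ((!) (map rset bs)) q" using satN by blast
    qed
  qed
  then show ?case unfolding q_def .
qed

end


subsection \<open>Cardinalities\<close>

instance bf :: countable
  by countable_datatype

text \<open>Sets smaller than \<open>\<omega>\<^sub>1\<close> are countable, so an uncountable
  \<kappa> has room for all coordinates. This is where uncountability of \<kappa> enters the
  cardinality count.\<close>

lemma card_suc_nat_le: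
  assumes "Card_order \<kappa>" "natLeq <o \<kappa>"
  shows "|UNIV :: nat suc set| \<le>o \<kappa>"
proof -
  have F: "|Field \<kappa>| =o \<kappa>" using assms(1) by (rule card_of_Field_ordIso)
  have "\<not> countable (Field \<kappa>)"
  proof
    assume "countable (Field \<kappa>)"
    then have "|Field \<kappa>| \<le>o natLeq" by (simp add: countable_le_natLeq)
    then have "|Field \<kappa>| <o \<kappa>" using assms(2) by (rule ordLeq_ordLess_trans)
    then show False using F not_ordLess_ordIso by blast
  qed
  then have "\<not> |Field \<kappa>| <o card_suc |UNIV :: nat set|" by (simp add: suc_nat_less)
  then have "card_suc |UNIV :: nat set| \<le>o |Field \<kappa>|"
    by (rule iffD1[OF not_ordLess_iff_ordLeq[OF card_order_on_well_order_on[OF Card_order_suc] card_of_Well_order]])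
  moreover have "|UNIV :: nat suc set| =o card_suc |UNIV :: nat set|"
    using card_of_Field_ordIso[OF Card_order_suc[where 'a = nat]] by (simp add: Field_suc)
  ultimately show ?thesis using F by (blast intro: ordIso_ordLeq_trans ordLeq_ordIso_trans)
qed

section \<open>Sets of size at most an infinite cardinal \<kappa>\<close>

context
  fixes \<kappa> :: "'k rel"
  assumes \<kappa>: "Card_order \<kappa>" "natLeq \<le>o \<kappa>"
begin

lemma infinite_Field: "infinite (Field \<kappa>)"
proof
  assume "finite (Field \<kappa>)"
  then have "|Field \<kappa>| <o natLeq" by (simp add: finite_iff_ordLess_natLeq)
  moreover have "natLeq \<le>o |Field \<kappa>|"
    using \<kappa>(2) ordIso_symmetric[OF card_of_Field_ordIso[OF \<kappa>(1)]] by (rule ordLeq_ordIso_trans)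
  ultimately show False using not_ordLess_ordLeq by blast
qed

lemma card_le_countable: "countable A \<Longrightarrow> |A| \<le>o \<kappa>"
  using \<kappa>(2) ordLeq_transitive by (auto simp: countable_le_natLeq)

lemma card_le_image: "|A| \<le>o \<kappa> \<Longrightarrow> |f ` A| \<le>o \<kappa>"
  using card_of_image ordLeq_transitive by blast

lemma card_le_Un: "|A| \<le>o \<kappa> \<Longrightarrow> |B| \<le>o \<kappa> \<Longrightarrow> |A \<union> B| \<le>o \<kappa>"
  by (rule card_of_Un_ordLeq_infinite_Field[OF infinite_Field]) (use \<kappa> in auto)

lemma card_le_Times: "|A| \<le>o \<kappa> \<Longrightarrow> |B| \<le>o \<kappa> \<Longrightarrow> |A \<times> B| \<le>o \<kappa>"
  by (rule card_of_Times_ordLeq_infinite_Field[OF infinite_Field]) (use \<kappa> in auto)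

lemma card_le_UN: "|I| \<le>o \<kappa> \<Longrightarrow> (\<And>i. i \<in> I \<Longrightarrow> |A i| \<le>o \<kappa>) \<Longrightarrow> |\<Union>i\<in>I. A i| \<le>o \<kappa>"
  by (rule card_of_UNION_ordLeq_infinite_Field[OF infinite_Field]) (use \<kappa> in auto)

lemma card_le_mono: "A \<subseteq> B \<Longrightarrow> |B| \<le>o \<kappa> \<Longrightarrow> |A| \<le>o \<kappa>"
  using card_of_mono1 ordLeq_transitive by blast

lemma card_le_lists:
  assumes "|A| \<le>o \<kappa>"
  shows "|lists A| \<le>o \<kappa>"
proof -
  have n: "|{xs \<in> lists A. length xs = n}| \<le>o \<kappa>" for n
  proof (induction n)
    case 0
    have "{xs \<in> lists A. length xs = 0} \<subseteq> {[]}" by auto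
    then show ?case by (rule card_le_mono) (rule card_le_countable, simp)
  next
    case (Suc n)
    have "{xs \<in> lists A. length xs = Suc n} \<subseteq> (\<lambda>(x, xs). x # xs) ` (A \<times> {xs \<in> lists A. length xs = n})"
      by (auto simp: length_Suc_conv)
    then show ?case by (rule card_le_mono) (intro card_le_image card_le_Times assms Suc)
  qed
  have "|\<Union>n. {xs \<in> lists A. length xs = n}| \<le>o \<kappa>"
    by (rule card_le_UN, rule card_le_countable, simp, rule n)
  then show ?thesis by (rule card_le_mono[rotated]) auto
qed

text \<open>The closure is exhausted by countably many stages: these increase, so the finitely many
  arguments of an operation lie in a common stage.\<close>

lemma card_le_clo:
  assumes "|Ops| \<le>o \<kappa>"
  shows "|clo Ops| \<le>o \<kappa>"
proof -
  define step where "step X = X \<union> (\<lambda>(h, cs). h cs) ` (Ops \<times> lists X)" for X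
  define S where "S n = (step ^^ n) {}" for n
  have S_Suc: "S (Suc n) = S n \<union> (\<lambda>(h, cs). h cs) ` (Ops \<times> lists (S n))" for n
    by (simp add: S_def step_def)
  have card: "|S n| \<le>o \<kappa>" for n
  proof (induction n)
    case 0
    show ?case by (rule card_le_countable) (simp add: S_def)
  next
    case (Suc n)
    then show ?case unfolding S_Suc by (intro card_le_Un card_le_image card_le_Times card_le_lists assms)
  qed
  have mono: "S m \<subseteq> S n" if "m \<le> n" for m n
    using that by (rule lift_Suc_mono_le[rotated]) (simp add: S_Suc)
  have "c \<in> (\<Union>n. S n)" if "c \<in> clo Ops" for c
    using that
  proof induction
    case (clo h cs)
    have "\<exists>n. set cs \<subseteq> S n"
      using clo(2)
    proof (induction cs)
      case (Cons c cs)
      then obtain m n where "c \<in> S m" "set cs \<subseteq> S n" by auto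
      then have "set (c # cs) \<subseteq> S (max m n)" using mono[of m "max m n"] mono[of n "max m n"] by auto
      then show ?case by blast
    qed simp
    then obtain n where "cs \<in> lists (S n)" by auto
    then have "h cs \<in> S (Suc n)" unfolding S_Suc using clo(1) by force
    then show ?case by blast
  qed
  then have "clo Ops \<subseteq> (\<Union>n. S n)" by blast
  then show ?thesis by (rule card_le_mono) (rule card_le_UN, rule card_le_countable, simp, rule card)
qed

end

section \<open>Models of controlled size\<close>

context iterated_power
begin

text \<open>The operations are indexed by constants, by formulas and function symbols from
  \<open>T\<close>, by tree formulas and by finite lists of countable ordinals, at most \<kappa> of
  each kind.\<close>

lemma card_CC:
  assumes \<kappa>: "Card_order \<kappa>" "natLeq <o \<kappa>" and T: "|T| \<le>o \<kappa>" and C: "|C| \<le>o \<kappa>"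
  shows "|CC| \<le>o \<kappa>"
proof -
  note \<kappa>' = \<kappa>(1) ordLess_imp_ordLeq[OF \<kappa>(2)]
  note c = card_le_countable[OF \<kappa>'] and im = card_le_image[OF \<kappa>'] and un = card_le_Un[OF \<kappa>']
    and ti = card_le_Times[OF \<kappa>'] and li = card_le_lists[OF \<kappa>']
  have \<Phi>: "|\<Phi>| \<le>o \<kappa>" unfolding \<Phi>_def
    by (rule card_le_UN[OF \<kappa>' T]) (rule c, rule countable_finite, rule finite_subf)
  have Fs: "|Fs| \<le>o \<kappa>" unfolding Fs_def
    by (rule card_le_UN[OF \<kappa>' T]) (rule c, rule countable_finite, rule finite_funs_fm)
  have "|UNIV :: nat suc list set| \<le>o \<kappa>"
    using li[OF card_suc_nat_le[OF \<kappa>]] by simp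
  moreover have "|Hs| \<le>o \<kappa>"
    unfolding Hs_def by (intro un im ti \<Phi> Fs C c) auto
  moreover have "|UNIV :: nat set| \<le>o \<kappa>" by (rule c) simp
  ultimately have "|Ops| \<le>o \<kappa>"
    unfolding Ops_def by (intro un im ti)
  then show ?thesis unfolding CC_def by (rule card_le_clo[OF \<kappa>'])
qed

lemma eventually_W_fst:
  assumes "eventually P E"
  shows "eventually (\<lambda>\<omega>. P (fst \<omega>)) W"
  using eventually_iter_filter_depends[OF ultra_E ultra_D, of "{}" "\<lambda>\<omega>. P (fst \<omega>)"] assms
  by (simp add: depends_def)

text \<open>Common core of compactness and the spectrum. The constants \<open>c i\<close> differ
  almost everywhere, which bounds the universe from below; coding the classes of \<open>CC\<close>
  inside the field of \<kappa> bounds it from above.\<close>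

lemma ex_model:
  fixes \<kappa> :: "'k rel" and c :: "'i \<Rightarrow> 's \<Rightarrow> 'a"
  assumes T: "\<forall>\<phi>\<in>T. sentence \<phi>" "\<And>\<phi>. \<phi> \<in> T \<Longrightarrow> eventually (\<lambda>S. \<forall>e s. sat (M S) e s \<phi>) E"
    and \<kappa>: "Card_order \<kappa>" "natLeq <o \<kappa>" "|T| \<le>o \<kappa>" "|I| \<le>o \<kappa>"
    and C: "C = c ` I" "\<And>i. i \<in> I \<Longrightarrow> eventually (\<lambda>S. c i S \<in> univ (M S)) E"
      "\<And>i j. i \<in> I \<Longrightarrow> j \<in> I \<Longrightarrow> i \<noteq> j \<Longrightarrow> eventually (\<lambda>S. c i S \<noteq> c j S) E"
  shows "\<exists>N :: ('f, 'p, 'k) struct. is_model N T \<and> |univ N| \<le>o \<kappa> \<and> |I| \<le>o |univ N|"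
proof -
  have "|C| \<le>o \<kappa>" unfolding C by (rule card_le_image[OF \<kappa>(1) ordLess_imp_ordLeq[OF \<kappa>(2)] \<kappa>(4)])
  then have CC: "|CC| \<le>o \<kappa>" using card_CC \<kappa> by blast
  define cls where "cls c = {d \<in> CC. eventually (\<lambda>\<omega>. el c \<omega> = el d \<omega>) W}" for c
  have cls: "cls c = cls d \<longleftrightarrow> eventually (\<lambda>\<omega>. el c \<omega> = el d \<omega>) W" if "c \<in> CC" "d \<in> CC" for c d
  proof
    assume "cls c = cls d"
    moreover have "d \<in> cls d" using that by (simp add: cls_def)
    ultimately have "d \<in> cls c" by simp
    then show "eventually (\<lambda>\<omega>. el c \<omega> = el d \<omega>) W" by (simp add: cls_def)
  next
    assume eq: "eventually (\<lambda>\<omega>. el c \<omega> = el d \<omega>) W"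
    have "eventually (\<lambda>\<omega>. el c \<omega> = el x \<omega>) W \<longleftrightarrow> eventually (\<lambda>\<omega>. el d \<omega> = el x \<omega>) W" for x
      by (rule eventually_subst) (use eq in \<open>eventually_elim, simp\<close>)
    then show "cls c = cls d" by (simp add: cls_def)
  qed
  have "|cls ` CC| \<le>o |Field \<kappa>|"
    using card_le_image[OF \<kappa>(1) ordLess_imp_ordLeq[OF \<kappa>(2)] CC] ordIso_symmetric[OF card_of_Field_ordIso[OF \<kappa>(1)]]
    by (rule ordLeq_ordIso_trans)
  then obtain f where f: "inj_on f (cls ` CC)" "f ` cls ` CC \<subseteq> Field \<kappa>"
    unfolding card_of_ordLeq[symmetric] by blast
  define \<rho> where "\<rho> c = f (cls c)" for c
  interpret iterated_model M E C T \<rho>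
  proof
    show "\<rho> c = \<rho> d \<longleftrightarrow> eventually (\<lambda>\<omega>. el c \<omega> = el d \<omega>) W" if "c \<in> CC" "d \<in> CC" for c d
      unfolding \<rho>_def using inj_on_eq_iff[OF f(1), of "cls c" "cls d"] cls that by simp
  qed
  have "is_model N T"
    unfolding is_model_def
  proof (intro conjI struct_N ballI allI impI)
    fix \<phi> e and s :: "nat \<Rightarrow> 'k set" assume \<phi>: "\<phi> \<in> T"
    then have cl: "closed_fm 0 0 \<phi>" using T by (simp add: sentence_def)
    have "eventually (\<lambda>\<omega>. sat (M (fst \<omega>)) (ele [] \<omega>) (eva [] \<omega>) \<phi>) W"
      using eventually_W_fst[OF T(2)[OF \<phi>]] by eventually_elim simp
    then have "sat N ((!) (map \<rho> [])) ((!) (map rset [])) \<phi>"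
      using \<phi> cl by (subst los) (auto simp: \<Phi>_def Fs_def)
    then show "sat N e s \<phi>" using sat_cong[OF cl, of e "(!) (map \<rho> [])" s "(!) (map rset [])" N] by simp
  qed
  moreover have "|univ N| \<le>o \<kappa>"
    unfolding univ_N by (rule card_le_image[OF \<kappa>(1) ordLess_imp_ordLeq[OF \<kappa>(2)] CC])
  moreover have "|I| \<le>o |univ N|"
  proof -
    define k where "k i = (\<lambda>\<omega> :: ('s, 'a) point. {c i (fst \<omega>)})" for i
    have k: "k i \<in> CC" if "i \<in> I" for i unfolding k_def by (rule CC_const) (use that C in auto)
    have el_k: "eventually (\<lambda>\<omega>. el (k i) \<omega> = c i (fst \<omega>)) W" if "i \<in> I" for i
      using eventually_W_fst[OF C(2)[OF that]]
      by eventually_elim (simp add: el_def k_def pick_singleton)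
    have "i = j" if ij: "i \<in> I" "j \<in> I" "\<rho> (k i) = \<rho> (k j)" for i j
    proof (rule ccontr)
      assume "i \<noteq> j"
      have "eventually (\<lambda>\<omega>. el (k i) \<omega> = el (k j) \<omega>) W" using ij k \<rho> by simp
      with el_k[OF ij(1)] el_k[OF ij(2)] eventually_W_fst[OF C(3)[OF ij(1,2) \<open>i \<noteq> j\<close>]]
      have "eventually (\<lambda>\<omega>. False) W" by eventually_elim simp
      then show False using ultra_W by (simp add: ultra_const)
    qed
    then have "inj_on (\<lambda>i. \<rho> (k i)) I" by (auto intro: inj_onI)
    moreover have "(\<lambda>i. \<rho> (k i)) ` I \<subseteq> univ N" using k by (auto simp: univ_N)
    ultimately show ?thesis using card_of_ordLeq by blast
  qed
  ultimately show ?thesis by blast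
qed

end

subsection \<open>Compactness and the spectrum\<close>

text \<open>\<open>is_model\<close> considers only assignments into the universe; the truth of a
  sentence is the same under a constant assignment of that kind.\<close>

lemma is_model_sat:
  assumes "is_model M T" "\<phi> \<in> T" "sentence \<phi>"
  shows "sat M e s \<phi>"
proof -
  obtain a where "a \<in> univ M" using assms(1) by (auto simp: is_model_def is_struct_def)
  then have "sat M (\<lambda>_. a) s \<phi>" using assms(1,2) by (auto simp: is_model_def)
  then show ?thesis using sat_cong[of 0 0 \<phi> e "\<lambda>_. a" s s M] assms(3) by (simp add: sentence_def)
qed

lemma compactness:
  fixes T :: "('f, 'p) fm set"
  assumes T: "\<forall>\<phi>\<in>T. sentence \<phi>"
    and fin: "\<And>S. S \<subseteq> T \<Longrightarrow> finite S \<Longrightarrow> \<exists>M :: ('f, 'p, 'a) struct. is_model M S"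
  shows "\<exists>M :: ('f, 'p, ('f, 'p) fm set) struct. is_model M T"
proof -
  \<comment> \<open>Indices that are not finite subsets of \<open>T\<close> get a model of the empty
    theory as a filler.\<close>
  have "\<exists>M :: ('f, 'p, 'a) struct. is_struct M \<and> (S \<subseteq> T \<and> finite S \<longrightarrow> is_model M S)" for S
    using fin[of S] fin[of "{}"] by (cases "S \<subseteq> T \<and> finite S") (auto simp: is_model_def)
  then obtain M :: "('f, 'p) fm set \<Rightarrow> ('f, 'p, 'a) struct"
    where M: "\<And>S. is_struct (M S)" "\<And>S. S \<subseteq> T \<Longrightarrow> finite S \<Longrightarrow> is_model (M S) S"
    by metis
  define E where "E = ultra_below (finite_subsets_at_top T)"
  interpret iterated_power M E "{}" T
    by unfold_locales (auto simp: E_def ultra_below M)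
  \<comment> \<open>The power set of the infinite set of formulas is uncountable and larger than
    \<open>T\<close>; its type is the one named in the conclusion.\<close>
  let ?\<kappa> = "|UNIV :: ('f, 'p) fm set set|"
  have "\<exists>N :: ('f, 'p, ('f, 'p) fm set) struct.
      is_model N T \<and> |univ N| \<le>o ?\<kappa> \<and> |{} :: nat set| \<le>o |univ N|"
  proof (rule ex_model[OF T])
    fix \<phi> assume \<phi>: "\<phi> \<in> T"
    have "eventually (\<lambda>S. \<forall>e s. sat (M S) e s \<phi>) (finite_subsets_at_top T)"
      unfolding eventually_finite_subsets_at_top
    proof (rule exI[of _ "{\<phi>}"], intro conjI allI impI)
      fix S e s assume S: "finite S \<and> {\<phi>} \<subseteq> S \<and> S \<subseteq> T"
      show "sat (M S) e s \<phi>" by (rule is_model_sat[OF M(2)]) (use S T \<phi> in auto)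
    qed (use \<phi> in auto)
    then show "eventually (\<lambda>S. \<forall>e s. sat (M S) e s \<phi>) E"
      unfolding E_def by (rule filter_leD[OF ultra_below(1), rotated]) simp
  next
    \<comment> \<open>The numbering of branch variables yields infinitely many formulas in every
      vocabulary.\<close>
    have "inj (\<lambda>n. InBr n (Var 0) :: ('f, 'p) fm)" by (auto intro: injI)
    then have "infinite (UNIV :: ('f, 'p) fm set)" using finite_imageD[of "\<lambda>n. InBr n (Var 0)" UNIV] finite_subset[OF subset_UNIV] infinite_UNIV_nat by blast
    then have "natLeq \<le>o |UNIV :: ('f, 'p) fm set|" using infinite_iff_natLeq_ordLeq by blast
    moreover have less: "|UNIV :: ('f, 'p) fm set| <o ?\<kappa>" using card_of_Pow[of UNIV] by simp
    ultimately show "natLeq <o ?\<kappa>" by (rule ordLeq_ordLess_trans)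
    have "|T| \<le>o |UNIV :: ('f, 'p) fm set|" by (rule card_of_mono1) simp
    then show "|T| \<le>o ?\<kappa>" using ordLess_imp_ordLeq[OF less] by (rule ordLeq_transitive)
  qed (auto simp: card_of_Card_order card_of_empty)
  then show ?thesis by blast
qed

text \<open>An ultrapower of \<open>M\<close> alone, indexed by subsets \<open>X\<close> of the
  field of \<kappa>. On a finite \<open>X\<close> the map \<open>z X\<close> names its members by
  distinct elements of the infinite universe, so the \<kappa> constants are pairwise distinct almost
  everywhere.\<close>

lemma spectrum:
  fixes T :: "('f, 'p) fm set" and M :: "('f, 'p, 'a) struct" and \<kappa> :: "'k rel"
  assumes T: "\<forall>\<phi>\<in>T. sentence \<phi>" and M: "is_model M T" "infinite (univ M)"
    and \<kappa>: "Card_order \<kappa>" "natLeq <o \<kappa>" "|T| \<le>o \<kappa>"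
  shows "\<exists>N :: ('f, 'p, 'k) struct. is_model N T \<and> |univ N| =o \<kappa>"
proof -
  have "\<exists>z. X \<subseteq> Field \<kappa> \<and> finite X \<longrightarrow> inj_on z X \<and> z ` X \<subseteq> univ M" for X
  proof (cases "finite X")
    case True
    obtain B where "finite B" "card B = card X" "B \<subseteq> univ M"
      using infinite_arbitrarily_large[OF M(2), of "card X"] by blast
    then obtain z where "bij_betw z X B" using finite_same_card_bij[OF True] by metis
    then show ?thesis using \<open>B \<subseteq> univ M\<close> by (auto simp: bij_betw_def)
  qed simp
  then obtain z where z: "\<And>X. X \<subseteq> Field \<kappa> \<Longrightarrow> finite X \<Longrightarrow> inj_on (z X) X \<and> z X ` X \<subseteq> univ M"
    by metis
  define E where "E = ultra_below (finite_subsets_at_top (Field \<kappa>))"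
  define c where "c i X = z X i" for i X
  have E: "eventually P E" if "eventually P (finite_subsets_at_top (Field \<kappa>))" for P
    unfolding E_def by (rule filter_leD[OF ultra_below(1) that]) simp
  interpret iterated_power "\<lambda>_ :: 'k set. M" E "c ` Field \<kappa>" T
    using M(1) by unfold_locales (auto simp: E_def ultra_below is_model_def)
  have F: "|Field \<kappa>| =o \<kappa>" using \<kappa>(1) by (rule card_of_Field_ordIso)
  have "\<exists>N :: ('f, 'p, 'k) struct. is_model N T \<and> |univ N| \<le>o \<kappa> \<and> |Field \<kappa>| \<le>o |univ N|"
  proof (rule ex_model[OF T _ \<kappa> _ refl])
    show "eventually (\<lambda>S. \<forall>e s. sat M e s \<phi>) E" if "\<phi> \<in> T" for \<phi>
      using is_model_sat[OF M(1) that] T that by simp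
    show "|Field \<kappa>| \<le>o \<kappa>" using F by (rule ordIso_imp_ordLeq)
    show "eventually (\<lambda>S. c i S \<in> univ M) E" if "i \<in> Field \<kappa>" for i
    proof (rule E, unfold eventually_finite_subsets_at_top, rule exI[of _ "{i}"], intro conjI allI impI)
      fix X assume "finite X \<and> {i} \<subseteq> X \<and> X \<subseteq> Field \<kappa>"
      then show "c i X \<in> univ M" using z[of X] by (auto simp: c_def)
    qed (use that in auto)
    show "eventually (\<lambda>S. c i S \<noteq> c j S) E" if "i \<in> Field \<kappa>" "j \<in> Field \<kappa>" "i \<noteq> j" for i j
    proof (rule E, unfold eventually_finite_subsets_at_top, rule exI[of _ "{i, j}"], intro conjI allI impI)
      fix X assume "finite X \<and> {i, j} \<subseteq> X \<and> X \<subseteq> Field \<kappa>"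
      then show "c i X \<noteq> c j X" using z[of X] that(3) by (auto simp: c_def dest: inj_onD)
    qed (use that in auto)
  qed
  then obtain N :: "('f, 'p, 'k) struct" where N: "is_model N T" "|univ N| \<le>o \<kappa>" "|Field \<kappa>| \<le>o |univ N|"
    by blast
  have "\<kappa> \<le>o |univ N|" using ordIso_symmetric[OF F] N(3) by (rule ordIso_ordLeq_trans)
  then have "|univ N| =o \<kappa>" using N(2) by (simp add: ordIso_iff_ordLeq)
  then show ?thesis using N(1) by blast
qed

theorem theorem3p4:
  fixes T :: "('f, 'p) fm set"
  assumes "\<forall>\<phi>\<in>T. sentence \<phi>"
  shows "((\<forall>S. S \<subseteq> T \<and> finite S \<longrightarrow> (\<exists>M :: ('f, 'p, 'a) struct. is_model M S))
            \<longrightarrow> (\<exists>M :: ('f, 'p, ('f, 'p) fm set) struct. is_model M T))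
       \<and> ((\<exists>M :: ('f, 'p, 'a) struct. is_model M T \<and> infinite (univ M))
            \<longrightarrow> (\<forall>\<kappa> :: 'k rel. Card_order \<kappa> \<and> natLeq <o \<kappa> \<and> |T| <o \<kappa>
                  \<longrightarrow> (\<exists>M :: ('f, 'p, 'k) struct. is_model M T \<and> |univ M| =o \<kappa>)))"
proof (intro conjI impI allI)
  assume "\<forall>S. S \<subseteq> T \<and> finite S \<longrightarrow> (\<exists>M :: ('f, 'p, 'a) struct. is_model M S)"
  then show "\<exists>M :: ('f, 'p, ('f, 'p) fm set) struct. is_model M T"
    using compactness[OF assms] by blast
next
  fix \<kappa> :: "'k rel"
  assume "\<exists>M :: ('f, 'p, 'a) struct. is_model M T \<and> infinite (univ M)"
    and \<kappa>: "Card_order \<kappa> \<and> natLeq <o \<kappa> \<and> |T| <o \<kappa>"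
  then obtain M :: "('f, 'p, 'a) struct" where M: "is_model M T" "infinite (univ M)" by blast
  show "\<exists>M :: ('f, 'p, 'k) struct. is_model M T \<and> |univ M| =o \<kappa>"
    by (rule spectrum[OF assms M]) (use \<kappa> ordLess_imp_ordLeq in auto)
qed

end
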